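(* For nonnegative integers $l,k$, \[ \sum_{n=0}^\infty\frac{Q_l(H_n,\dots,H_n^{(l)})\,P_k(H_n,\dots,H_n^{(k)})}{(n+1)^2}=\binom{l+k+1}{k+1}\zeta(l+k+2)-\sum_{p=k}^{l+k-1}\binom{p}{k}S^R_{l+k+2,\,l+k+1-p}. \]
   Context: For integers $r\ge1$ and $n\ge0$, $H_n^{(r)}=\sum_{t=1}^n t^{-r}$ (so $H_0^{(r)}=0$), $H_n=H_n^{(1)}$. $P_0=Q_0=1$ and for $n\ge1$, $P_n(y_1,\dots,y_n)=\sum_{m_1+2m_2+\cdots=n}\frac{(-1)^{m_2+m_4+\cdots}}{m_1!m_2!\cdots}\prod_{i\ge1}(y_i/i)^{m_i}$, $Q_n(y_1,\dots,y_n)=\sum_{m_1+2m_2+\cdots=n}\frac{1}{m_1!m_2!\cdots}\prod_{i\ge1}(y_i/i)^{m_i}$. Multiple zeta values: $\zeta(a_1,\dots,a_d)=\sum_{n_1>\cdots>n_d\ge1}n_1^{-a_1}\cdots n_d^{-a_d}$ for positive integers with $a_1\ge2$; weight $a_1+\dots+a_d$, depth $d$. $S^R_{N,d}$ denotes the sum of all multiple zeta values of weight $N$ and depth $d$ whose last argument $a_d$ equals $1$. (An empty sum is $0$.) *)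

theory Defs
  imports "HOL-Analysis.Analysis"
begin

definition harm :: "nat \<Rightarrow> nat \<Rightarrow> real" where
  "harm r n = (\<Sum>t=1..n. 1 / real t ^ r)"

definition mult_vecs :: "nat \<Rightarrow> (nat \<Rightarrow> nat) set" where
  "mult_vecs n = {m. (\<forall>i. i \<notin> {1..n} \<longrightarrow> m i = 0) \<and> (\<Sum>i=1..n. i * m i) = n}"

definition Ppoly :: "nat \<Rightarrow> (nat \<Rightarrow> real) \<Rightarrow> real" where
  "Ppoly n y = (\<Sum>m\<in>mult_vecs n.
      (-1) ^ (\<Sum>i\<in>{i\<in>{1..n}. even i}. m i) / (\<Prod>i=1..n. fact (m i))
      * (\<Prod>i=1..n. (y i / real i) ^ m i))"

definition Qpoly :: "nat \<Rightarrow> (nat \<Rightarrow> real) \<Rightarrow> real" where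
  "Qpoly n y = (\<Sum>m\<in>mult_vecs n.
      1 / (\<Prod>i=1..n. fact (m i)) * (\<Prod>i=1..n. (y i / real i) ^ m i))"

text \<open>Multiple zeta value zeta(a_1,...,a_d) = sum over n_1 > ... > n_d >= 1
  (list index 0 corresponds to a_1).\<close>
definition mzv :: "nat list \<Rightarrow> real" where
  "mzv a = infsum (\<lambda>ns. \<Prod>i<length a. 1 / real (ns ! i) ^ (a ! i))
      {ns. length ns = length a \<and> sorted_wrt (>) ns \<and> (\<forall>x\<in>set ns. x \<ge> 1)}"

definition SR :: "nat \<Rightarrow> nat \<Rightarrow> real" where
  "SR N d = (\<Sum>a\<in>{a. length a = d \<and> (\<forall>x\<in>set a. x \<ge> 1) \<and> sum_list a = N
                   \<and> a \<noteq> [] \<and> hd a \<ge> 2 \<and> last a = 1}. mzv a)"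

end

theory Submission
  imports Defs "HOL-Computational_Algebra.Formal_Power_Series"
begin

text \<open>
  By Newton's identities \<open>Q\<^sub>l\<close> and \<open>P\<^sub>k\<close> at the harmonic numbers are the complete and elementary symmetric
  functions \<open>h\<^sub>l(n)\<close>, \<open>e\<^sub>k(n)\<close> of \<open>1, 1/2, \<dots>, 1/n\<close>. With the connector \<open>C(n,j) = n! j! / (n+j)!\<close> let
  \<open>R\<^sub>j\<close> have the coefficients \<open>R\<^sub>j[l,k] = \<Sum> h\<^sub>l(n) e\<^sub>k(n-1) C(n,j) / n\<^sup>2\<close> (sum over \<open>n \<ge> 1\<close>). Since
  \<open>h\<^sub>l(n-1) = h\<^sub>l(n) - h\<^sub>l\<^sub>-\<^sub>1(n)/n\<close> and \<open>1/n = \<Sum> C(n,j)/j\<close> (sum over \<open>j \<ge> 1\<close>), the series in question is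
  \<open>R\<^sub>0[l,k] - \<Sum> R\<^sub>j[l-1,k]/j\<close>.

  A telescoping sum gives \<open>(j-x-y) R\<^sub>j\<^sub>-\<^sub>1 - (j-y) R\<^sub>j = 1/j\<close> for the generating functions in \<open>x\<close>, \<open>y\<close>. The
  generating function of the tails (all indices larger than \<open>j\<close>) of multiple zeta values, in which
  \<open>x\<close> marks the depth and \<open>x+y\<close> the weight minus the depth, satisfies the same recursion, and both
  vanish for \<open>j \<rightarrow> \<infinity>\<close>, so they agree; summation against \<open>1/j\<close> appends the final argument 1. The
  value \<open>R\<^sub>0[l,k]\<close> is a binomial coefficient times \<open>\<zeta>(l+k+2)\<close> by a double sum that telescopes in
  both directions. Everything is carried out on coefficients.
\<close>

section \<open>Newton's identities\<close>

text \<open>The length bound and the weight, which coincide in \<open>mult_vecs\<close>, are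
  decoupled, so that vectors of the weights n and n - i live over one index range.\<close>

definition weighted_vecs :: "nat \<Rightarrow> nat \<Rightarrow> (nat \<Rightarrow> nat) set" where
  "weighted_vecs N n = {m. (\<forall>i. i \<notin> {1..N} \<longrightarrow> m i = 0) \<and> (\<Sum>i=1..N. i * m i) = n}"

lemma weighted_vecs_le:
  assumes "m \<in> weighted_vecs N n"
  shows "i * m i \<le> n"
proof (cases "i \<in> {1..N}")
  case True
  have "i * m i \<le> (\<Sum>i=1..N. i * m i)"
    by (rule member_le_sum[OF True]) auto
  then show ?thesis using assms by (simp add: weighted_vecs_def)
next
  case False
  then show ?thesis using assms by (auto simp: weighted_vecs_def)
qed

lemma weighted_vecs_eq_0:
  assumes "m \<in> weighted_vecs N n" "n < i"
  shows "m i = 0"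
proof (rule ccontr)
  assume "m i \<noteq> 0"
  then have "i * 1 \<le> i * m i" by (intro mult_left_mono) auto
  with weighted_vecs_le[OF assms(1), of i] assms(2) show False by simp
qed

lemma finite_weighted_vecs: "finite (weighted_vecs N n)"
proof (rule finite_subset)
  show "weighted_vecs N n \<subseteq> {m. \<forall>i. (i \<in> {1..N} \<longrightarrow> m i \<in> {..n}) \<and> (i \<notin> {1..N} \<longrightarrow> m i = 0)}"
  proof
    fix m assume m: "m \<in> weighted_vecs N n"
    have "m i \<le> n" if "i \<in> {1..N}" for i
    proof -
      have "m i \<le> i * m i" using that by simp
      also have "\<dots> \<le> n" by (rule weighted_vecs_le[OF m])
      finally show ?thesis .
    qed
    with m show "m \<in> {m. \<forall>i. (i \<in> {1..N} \<longrightarrow> m i \<in> {..n}) \<and> (i \<notin> {1..N} \<longrightarrow> m i = 0)}"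
      by (simp add: weighted_vecs_def)
  qed
  show "finite {m. \<forall>i. (i \<in> {1..N} \<longrightarrow> m i \<in> {..n}) \<and> (i \<notin> {1..N} \<longrightarrow> m i = 0)}"
    by (rule finite_set_of_finite_funs) auto
qed

lemma weighted_vecs_eq_mult_vecs:
  assumes "n \<le> N"
  shows "weighted_vecs N n = mult_vecs n"
proof -
  have sub: "(\<Sum>i=1..N. i * m i) = (\<Sum>i=1..n. i * m i)" if "\<forall>i. i \<notin> {1..n} \<longrightarrow> m i = 0" for m :: "nat \<Rightarrow> nat"
    by (rule sum.mono_neutral_right) (use assms that in auto)
  have "m \<in> weighted_vecs N n \<longleftrightarrow> m \<in> mult_vecs n" for m
  proof
    assume m: "m \<in> weighted_vecs N n"
    have "m i = 0" if "i \<notin> {1..n}" for i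
      using that m weighted_vecs_eq_0[OF m, of i] by (cases "i = 0") (auto simp: weighted_vecs_def)
    with m sub[of m] show "m \<in> mult_vecs n" by (auto simp: weighted_vecs_def mult_vecs_def)
  next
    assume m: "m \<in> mult_vecs n"
    then show "m \<in> weighted_vecs N n"
      using sub[of m] assms by (auto simp: weighted_vecs_def mult_vecs_def)
  qed
  then show ?thesis by blast
qed

definition vec_term :: "nat \<Rightarrow> (nat \<Rightarrow> real) \<Rightarrow> (nat \<Rightarrow> nat) \<Rightarrow> real" where
  "vec_term N y m = (\<Prod>i=1..N. (y i / real i) ^ m i / fact (m i))"

lemma Qpoly_weighted:
  assumes "n \<le> N"
  shows "Qpoly n y = (\<Sum>m\<in>weighted_vecs N n. vec_term N y m)"
  unfolding Qpoly_def weighted_vecs_eq_mult_vecs[OF assms]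
proof (rule sum.cong[OF refl])
  fix m assume m: "m \<in> mult_vecs n"
  have "vec_term N y m = (\<Prod>i=1..n. (y i / real i) ^ m i / fact (m i))"
    unfolding vec_term_def
    by (rule prod.mono_neutral_right) (use assms m in \<open>auto simp: mult_vecs_def\<close>)
  then show "1 / (\<Prod>i=1..n. fact (m i)) * (\<Prod>i=1..n. (y i / real i) ^ m i) = vec_term N y m"
    by (simp add: prod_dividef)
qed

text \<open>Only the factor at i changes; it gains y_i / (i (m_i + 1)).\<close>

lemma vec_term_Suc:
  assumes "i \<in> {1..N}"
  shows "real i * real (Suc (m i)) * vec_term N y (m(i := Suc (m i))) = y i * vec_term N y m"
proof -
  have split: "vec_term N y m' = (y i / real i) ^ m' i / fact (m' i) *
      (\<Prod>t\<in>{1..N}-{i}. (y t / real t) ^ m' t / fact (m' t))" for m'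
    unfolding vec_term_def using assms by (simp add: prod.remove)
  have "(\<Prod>t\<in>{1..N}-{i}. (y t / real t) ^ (m(i := Suc (m i))) t / fact ((m(i := Suc (m i))) t))
      = (\<Prod>t\<in>{1..N}-{i}. (y t / real t) ^ m t / fact (m t))"
    by (rule prod.cong) auto
  then have *: "vec_term N y (m(i := Suc (m i))) = (y i / real i) ^ Suc (m i) / fact (Suc (m i)) *
      (\<Prod>t\<in>{1..N}-{i}. (y t / real t) ^ m t / fact (m t))"
    unfolding split[of "m(i := Suc (m i))"] by (simp only: fun_upd_same)
  have "real i * real (Suc (m i)) * ((y i / real i) ^ Suc (m i) / fact (Suc (m i)))
      = y i * ((y i / real i) ^ m i / fact (m i))"
    using assms by (simp add: divide_simps del: of_nat_Suc)
  then show ?thesis unfolding * split[of m] by (simp only: mult.assoc[symmetric])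
qed

lemma weighted_vecs_Suc_iff:
  assumes "i \<in> {1..N}"
  shows "m(i := Suc (m i)) \<in> weighted_vecs N (n + i) \<longleftrightarrow> m \<in> weighted_vecs N n"
proof -
  have *: "(\<Sum>t=1..N. t * m' t) = i * m' i + (\<Sum>t\<in>{1..N}-{i}. t * m' t)" for m' :: "nat \<Rightarrow> nat"
    using assms by (simp add: sum.remove)
  have "(\<Sum>t\<in>{1..N}-{i}. t * (m(i := Suc (m i))) t) = (\<Sum>t\<in>{1..N}-{i}. t * m t)"
    by (rule sum.cong) auto
  then have "(\<Sum>t=1..N. t * (m(i := Suc (m i))) t) = (\<Sum>t=1..N. t * m t) + i"
    unfolding *[of m] *[of "m(i := Suc (m i))"] by simp
  then show ?thesis using assms unfolding weighted_vecs_def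
    by (auto simp del: sum.cl_ivl_Suc)
qed

text \<open>The factor i m_i kills the vectors with m_i = 0; on the others, decrementing m_i is a
  bijection onto the vectors of weight n - i.\<close>

lemma weighted_sum_part:
  assumes "i \<in> {1..N}" "i \<le> n"
  shows "(\<Sum>m\<in>weighted_vecs N n. real (i * m i) * vec_term N y m)
       = y i * (\<Sum>m\<in>weighted_vecs N (n - i). vec_term N y m)"
proof -
  have "(\<Sum>m\<in>weighted_vecs N n. real (i * m i) * vec_term N y m)
      = (\<Sum>m\<in>{m \<in> weighted_vecs N n. m i > 0}. real (i * m i) * vec_term N y m)"
    by (rule sum.mono_neutral_right) (auto simp: finite_weighted_vecs)
  also have "\<dots> = (\<Sum>m\<in>weighted_vecs N (n - i). y i * vec_term N y m)"
  proof (rule sum.reindex_bij_witness[of _ "\<lambda>m. m(i := Suc (m i))" "\<lambda>m. m(i := m i - 1)"])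
    fix m assume m: "m \<in> {m \<in> weighted_vecs N n. m i > 0}"
    then have eq: "(m(i := m i - 1))(i := Suc ((m(i := m i - 1)) i)) = m" by auto
    then show "(m(i := m i - 1))(i := Suc ((m(i := m i - 1)) i)) = m" .
    show "m(i := m i - 1) \<in> weighted_vecs N (n - i)"
      using weighted_vecs_Suc_iff[OF assms(1), of "m(i := m i - 1)" "n - i"] m assms(2) eq by simp
    show "y i * vec_term N y (m(i := m i - 1)) = real (i * m i) * vec_term N y m"
      using vec_term_Suc[OF assms(1), of "m(i := m i - 1)" y] m eq by simp
  next
    fix m assume m: "m \<in> weighted_vecs N (n - i)"
    show "m(i := Suc (m i)) \<in> {m \<in> weighted_vecs N n. m i > 0}"
      using weighted_vecs_Suc_iff[OF assms(1), of m "n - i"] m assms(2) by simp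
  qed auto
  finally show ?thesis by (simp add: sum_distrib_left)
qed

text \<open>Writing n as the sum of the i m_i in every term splits the left side into the parts
  evaluated by \<open>weighted_sum_part\<close>.\<close>

lemma Qpoly_newton:
  "real n * Qpoly n y = (\<Sum>i=1..n. y i * Qpoly (n - i) y)"
proof -
  have "real n * Qpoly n y = (\<Sum>m\<in>weighted_vecs n n. real n * vec_term n y m)"
    by (simp add: Qpoly_weighted[of n n] sum_distrib_left)
  also have "\<dots> = (\<Sum>m\<in>weighted_vecs n n. \<Sum>i=1..n. real (i * m i) * vec_term n y m)"
  proof (rule sum.cong[OF refl])
    fix m assume "m \<in> weighted_vecs n n"
    then have "real n = real (\<Sum>i=1..n. i * m i)" by (simp add: weighted_vecs_def)
    then show "real n * vec_term n y m = (\<Sum>i=1..n. real (i * m i) * vec_term n y m)"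
      by (simp add: sum_distrib_right)
  qed
  also have "\<dots> = (\<Sum>i=1..n. \<Sum>m\<in>weighted_vecs n n. real (i * m i) * vec_term n y m)"
    by (rule sum.swap)
  also have "\<dots> = (\<Sum>i=1..n. y i * Qpoly (n - i) y)"
    by (rule sum.cong[OF refl], subst weighted_sum_part) (auto simp: Qpoly_weighted[of _ n])
  finally show ?thesis .
qed

lemma Qpoly_0: "Qpoly 0 y = 1"
proof -
  have "mult_vecs 0 = {\<lambda>_. 0}" by (auto simp: mult_vecs_def)
  then show ?thesis by (simp add: Qpoly_def)
qed

text \<open>The sign is the product of the powers ((-1)^(i-1))^(m_i), so it is absorbed into the
  arguments and one Newton identity serves both polynomials.\<close>

lemma Ppoly_eq_Qpoly: "Ppoly n y = Qpoly n (\<lambda>i. (-1) ^ (i - 1) * y i)"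
  unfolding Ppoly_def Qpoly_def
proof (rule sum.cong[OF refl])
  fix m assume "m \<in> mult_vecs n"
  have "(\<Prod>i=1..n. ((-1) ^ (i - 1)) ^ m i) = (\<Prod>i=1..n. if even i then (-1) ^ m i else (1::real))"
    by (rule prod.cong) auto
  also have "\<dots> = (\<Prod>i\<in>{i\<in>{1..n}. even i}. (-1) ^ m i)"
    by (rule prod.inter_filter[symmetric]) simp
  also have "\<dots> = (-1) ^ (\<Sum>i\<in>{i\<in>{1..n}. even i}. m i)"
    by (simp add: power_sum)
  finally have sgn: "(\<Prod>i=1..n. ((-1::real) ^ (i - 1)) ^ m i) = (-1) ^ (\<Sum>i\<in>{i\<in>{1..n}. even i}. m i)" .
  have "(\<Prod>i=1..n. ((-1) ^ (i - 1) * y i / real i) ^ m i)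
      = (\<Prod>i=1..n. ((-1) ^ (i - 1)) ^ m i * (y i / real i) ^ m i)"
    by (simp add: power_mult_distrib flip: times_divide_eq_right)
  also have "\<dots> = (-1) ^ (\<Sum>i\<in>{i\<in>{1..n}. even i}. m i) * (\<Prod>i=1..n. (y i / real i) ^ m i)"
    by (simp only: prod.distrib sgn)
  finally show "(-1) ^ (\<Sum>i\<in>{i\<in>{1..n}. even i}. m i) / (\<Prod>i=1..n. fact (m i)) * (\<Prod>i=1..n. (y i / real i) ^ m i)
     = 1 / (\<Prod>i=1..n. fact (m i)) * (\<Prod>i=1..n. ((-1) ^ (i - 1) * y i / real i) ^ m i)"
    by simp
qed

text \<open>Comparing coefficients in the differential equation gives the recursion
  \<open>Qpoly_newton\<close>, which together with the constant term determines everything.\<close>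

lemma fps_nth_eq_Qpoly:
  fixes G :: "real fps"
  assumes "fps_nth G 0 = 1" "fps_deriv G = G * Abs_fps (\<lambda>i. y (Suc i))"
  shows "fps_nth G n = Qpoly n y"
proof (induction n rule: less_induct)
  case (less n)
  show ?case
  proof (cases n)
    case 0
    then show ?thesis using assms by (simp add: Qpoly_0)
  next
    case (Suc m)
    have "real n * fps_nth G n = fps_nth (fps_deriv G) m" by (simp add: Suc)
    also have "\<dots> = fps_nth (Abs_fps (\<lambda>i. y (Suc i)) * G) m" by (simp add: assms mult.commute)
    also have "\<dots> = (\<Sum>i=0..m. y (Suc i) * fps_nth G (m - i))" by (simp add: fps_mult_nth)
    also have "\<dots> = (\<Sum>i=0..m. y (Suc i) * Qpoly (m - i) y)"
      by (intro sum.cong refl) (simp add: less Suc)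
    also have "\<dots> = (\<Sum>i=1..n. y i * Qpoly (n - i) y)"
      unfolding Suc by (rule sum.reindex_bij_witness[of _ "\<lambda>i. i - 1" Suc]) auto
    also have "\<dots> = real n * Qpoly n y" by (simp add: Qpoly_newton)
    finally show ?thesis using Suc by simp
  qed
qed

section \<open>Generating functions of the symmetric functions of 1, 1/2, ..., 1/n\<close>

definition complete_fps :: "nat \<Rightarrow> real fps" where
  "complete_fps n = (\<Prod>t=1..n. inverse (1 - fps_const (1 / real t) * fps_X))"

definition elementary_fps :: "nat \<Rightarrow> real fps" where
  "elementary_fps n = (\<Prod>t=1..n. 1 + fps_const (1 / real t) * fps_X)"

lemma complete_fps_0 [simp]: "complete_fps 0 = 1"
  and elementary_fps_0 [simp]: "elementary_fps 0 = 1"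
  by (simp_all add: complete_fps_def elementary_fps_def)

lemma complete_fps_Suc:
  "complete_fps (Suc n) * (1 - fps_const (1 / real (Suc n)) * fps_X) = complete_fps n"
proof -
  have "inverse (1 - fps_const (1 / real (Suc n)) * fps_X) * (1 - fps_const (1 / real (Suc n)) * fps_X) = 1"
    by (rule inverse_mult_eq_1) simp
  then show ?thesis by (simp add: complete_fps_def mult.assoc)
qed

lemma elementary_fps_Suc:
  "elementary_fps (Suc n) = elementary_fps n * (1 + fps_const (1 / real (Suc n)) * fps_X)"
  by (simp add: elementary_fps_def)

text \<open>The expansion of c / (1 - c x), multiplied out. It is what one linear factor contributes
  to a logarithmic derivative.\<close>

lemma geometric_fps:
  "Abs_fps (\<lambda>i. c ^ Suc i) * (1 - fps_const c * fps_X) = (fps_const c :: real fps)"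
  (is "?l = ?r")
proof (rule fps_ext)
  fix n show "fps_nth ?l n = fps_nth ?r n"
  proof (cases n)
    case (Suc k)
    then show ?thesis by (simp add: right_diff_distrib mult.assoc[symmetric] del: mult.assoc)
  qed (simp add: right_diff_distrib mult.assoc[symmetric])
qed

lemma harm_0 [simp]: "harm i 0 = 0"
  and harm_Suc: "harm i (Suc n) = harm i n + 1 / real (Suc n) ^ i"
  by (simp_all add: harm_def)

text \<open>The new factor 1 / (1 - c x) with c = 1/(n+1) adds c / (1 - c x) to the logarithmic
  derivative, so its coefficients accumulate the power sums.\<close>

lemma complete_fps_deriv:
  "fps_deriv (complete_fps n) = complete_fps n * Abs_fps (\<lambda>i. harm (Suc i) n)"
proof (induction n)
  case 0
  have "Abs_fps (\<lambda>i. 0) = (0 :: real fps)" by (rule fps_ext) simp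
  then show ?case by simp
next
  case (Suc n)
  define c where "c = 1 / real (Suc n)"
  define L where "L = 1 - fps_const c * fps_X"
  define G where "G = complete_fps (Suc n)"
  define Y where "Y = Abs_fps (\<lambda>i. harm (Suc i) n)"
  define K where "K = Abs_fps (\<lambda>i. c ^ Suc i)"
  have GL: "G * L = complete_fps n" unfolding G_def L_def c_def by (rule complete_fps_Suc)
  have L0: "L \<noteq> 0"
  proof
    assume "L = 0" then have "fps_nth L 0 = 0" by simp
    then show False by (simp add: L_def)
  qed
  have KL: "K * L = fps_const c" unfolding K_def L_def by (rule geometric_fps)
  have "fps_deriv (G * L) = G * L * Y" using Suc GL by (simp add: Y_def)
  then have "fps_deriv G * L = G * L * Y + G * fps_const c"
    by (simp add: L_def algebra_simps)
  also have "\<dots> = G * (Y + K) * L" unfolding KL[symmetric] by (simp add: algebra_simps)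
  finally have "fps_deriv G = G * (Y + K)" using L0 by simp
  moreover have "Y + K = Abs_fps (\<lambda>i. harm (Suc i) (Suc n))"
    by (rule fps_ext) (simp add: Y_def K_def harm_Suc c_def power_one_over)
  ultimately show ?case by (simp add: G_def)
qed

text \<open>Here a factor 1 + c x adds c / (1 + c x); the alternating signs come from
  \<open>geometric_fps\<close> at -c.\<close>

lemma elementary_fps_deriv:
  "fps_deriv (elementary_fps n) = elementary_fps n * Abs_fps (\<lambda>i. (-1) ^ i * harm (Suc i) n)"
proof (induction n)
  case 0
  have "Abs_fps (\<lambda>i. 0) = (0 :: real fps)" by (rule fps_ext) simp
  then show ?case by simp
next
  case (Suc n)
  define c where "c = 1 / real (Suc n)"
  define L where "L = 1 + fps_const c * fps_X"
  define G where "G = elementary_fps n"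
  define Y where "Y = Abs_fps (\<lambda>i. (-1) ^ i * harm (Suc i) n)"
  define K where "K = Abs_fps (\<lambda>i. (-1) ^ i * c ^ Suc i)"
  have "K = - Abs_fps (\<lambda>i. (- c) ^ Suc i)"
    by (rule fps_ext) (simp add: K_def power_minus[of c])
  then have KL: "K * L = fps_const c" using geometric_fps[of "- c"]
    by (simp add: L_def fps_const_neg[symmetric] del: fps_const_neg)
  have "fps_deriv (G * L) = G * Y * L + G * (K * L)"
    using Suc KL by (simp add: L_def Y_def G_def algebra_simps)
  also have "\<dots> = G * L * (Y + K)" by (simp add: algebra_simps)
  finally have "fps_deriv (G * L) = G * L * (Y + K)" .
  moreover have "Y + K = Abs_fps (\<lambda>i. (-1) ^ i * harm (Suc i) (Suc n))"
    by (rule fps_ext) (simp add: Y_def K_def harm_Suc c_def power_one_over distrib_left)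
  ultimately show ?case by (simp add: G_def L_def c_def elementary_fps_Suc)
qed

definition hsym :: "nat \<Rightarrow> nat \<Rightarrow> real" where "hsym l n = fps_nth (complete_fps n) l"
definition esym :: "nat \<Rightarrow> nat \<Rightarrow> real" where "esym k n = fps_nth (elementary_fps n) k"

lemma hsym_0_left [simp]: "hsym 0 n = 1"
proof (induction n)
  case (Suc n)
  have "hsym 0 n = fps_nth (complete_fps (Suc n) * (1 - fps_const (1 / real (Suc n)) * fps_X)) 0"
    by (simp only: hsym_def complete_fps_Suc)
  then show ?case using Suc by (simp add: hsym_def)
qed (simp add: hsym_def)

lemma esym_0_left [simp]: "esym 0 n = 1"
  by (induction n) (simp_all add: esym_def elementary_fps_Suc)

lemma hsym_0_right [simp]: "hsym (Suc l) 0 = 0"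
  and esym_0_right [simp]: "esym (Suc k) 0 = 0"
  by (simp_all add: hsym_def esym_def)

text \<open>The variable 1/(n+1) may be used repeatedly, hence \<open>Suc n\<close> also in the last
  term. In \<open>esym_Suc\<close> it occurs at most once, hence \<open>n\<close> there.\<close>

lemma hsym_Suc: "hsym (Suc l) (Suc n) = hsym (Suc l) n + hsym l (Suc n) / real (Suc n)"
proof -
  have "hsym (Suc l) n = fps_nth (complete_fps (Suc n) - fps_const (1 / real (Suc n)) * (fps_X * complete_fps (Suc n))) (Suc l)"
    unfolding hsym_def complete_fps_Suc[of n, symmetric] by (simp add: right_diff_distrib mult_ac)
  then show ?thesis by (simp add: hsym_def)
qed

lemma esym_Suc: "esym (Suc k) (Suc n) = esym (Suc k) n + esym k n / real (Suc n)"
proof -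
  have "esym (Suc k) (Suc n) = fps_nth (elementary_fps n + fps_const (1 / real (Suc n)) * (fps_X * elementary_fps n)) (Suc k)"
    unfolding esym_def elementary_fps_Suc by (simp add: distrib_left mult_ac)
  then show ?thesis by (simp add: esym_def)
qed

lemma Qpoly_harm: "Qpoly l (\<lambda>i. harm i n) = hsym l n"
  unfolding hsym_def using hsym_0_left[of n]
  by (intro fps_nth_eq_Qpoly[symmetric] complete_fps_deriv) (simp add: hsym_def)

lemma Ppoly_harm: "Ppoly k (\<lambda>i. harm i n) = esym k n"
  unfolding esym_def Ppoly_eq_Qpoly using esym_0_left[of n]
  by (intro fps_nth_eq_Qpoly[symmetric]) (simp_all add: esym_def elementary_fps_deriv)

section \<open>Connected sums\<close>

text \<open>The sequence \<open>f\<close> shifted by one, its value at index \<open>-1\<close> being read as 0.\<close>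
definition lower :: "(nat \<Rightarrow> real) \<Rightarrow> nat \<Rightarrow> real" where
  "lower f l = (case l of 0 \<Rightarrow> 0 | Suc l' \<Rightarrow> f l')"

lemma lower_0 [simp]: "lower f 0 = 0" and lower_Suc [simp]: "lower f (Suc l) = f l"
  by (simp_all add: lower_def)

section \<open>Recursions, growth and summability\<close>

lemma hsym_step: "hsym l (Suc n) = hsym l n + lower (\<lambda>l. hsym l (Suc n)) l / real (Suc n)"
  by (cases l) (simp_all add: hsym_Suc)

lemma esym_step: "esym k (Suc n) = esym k n + lower (\<lambda>k. esym k n) k / real (Suc n)"
  by (cases k) (simp_all add: esym_Suc)

lemma hsym_nonneg: "0 \<le> hsym l n"
proof (induction l arbitrary: n)
  case (Suc l)
  show ?case by (induction n) (simp_all add: hsym_Suc Suc)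
qed simp

lemma esym_nonneg: "0 \<le> esym k n"
proof (induction k arbitrary: n)
  case (Suc l)
  show ?case by (induction n) (simp_all add: esym_Suc Suc)
qed simp

lemma hsym_mono: "hsym l n \<le> hsym l (Suc n)"
  by (cases l) (simp_all add: hsym_Suc hsym_nonneg)

lemma esym_mono: "esym k n \<le> esym k (Suc n)"
  by (cases k) (simp_all add: esym_Suc esym_nonneg)

lemma harm_nonneg: "0 \<le> harm i n"
  by (induction n) (simp_all add: harm_Suc)

text \<open>Multiplying out h_l H_n produces every monomial of h_(l+1) at least once; the inner
  induction on n shows this bound by the recursions.\<close>

lemma hsym_le_power: "hsym l n \<le> harm 1 n ^ l"
proof (induction l)
  case (Suc l)
  have "hsym (Suc l) n \<le> hsym l n * harm 1 n"
  proof (induction n)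
    case (Suc n)
    have "hsym l n * harm 1 n \<le> hsym l (Suc n) * harm 1 n"
      by (intro mult_right_mono hsym_mono harm_nonneg)
    with Suc show ?case by (simp add: hsym_Suc harm_Suc distrib_left)
  qed simp
  also have "\<dots> \<le> harm 1 n ^ l * harm 1 n" by (intro mult_right_mono Suc harm_nonneg)
  finally show ?case by (simp add: mult.commute)
qed simp

lemma esym_le_power: "esym k n \<le> harm 1 n ^ k"
proof (induction k)
  case (Suc k)
  have "esym (Suc k) n \<le> esym k n * harm 1 n"
  proof (induction n)
    case (Suc n)
    have "esym k n * harm 1 n \<le> esym k (Suc n) * harm 1 n"
      by (intro mult_right_mono esym_mono harm_nonneg)
    moreover have "esym k n / real (Suc n) \<le> esym k (Suc n) / real (Suc n)"
      by (intro divide_right_mono esym_mono) simp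
    ultimately show ?case using Suc by (simp add: esym_Suc harm_Suc distrib_left)
  qed simp
  also have "\<dots> \<le> harm 1 n ^ k * harm 1 n" by (intro mult_right_mono Suc harm_nonneg)
  finally show ?case by (simp add: mult.commute)
qed simp

lemma harm_le_ln: "harm 1 (Suc n) \<le> 1 + ln (real (Suc n))"
proof (induction n)
  case (Suc n)
  have "ln (real (Suc n) / real (Suc (Suc n))) \<le> real (Suc n) / real (Suc (Suc n)) - 1"
    by (intro ln_le_minus_one) simp
  then have "1 / real (Suc (Suc n)) \<le> ln (real (Suc (Suc n))) - ln (real (Suc n))"
    by (simp add: ln_div field_simps)
  with Suc show ?case by (simp add: harm_Suc[of _ "Suc n"])
qed (simp add: harm_Suc)

lemma harm_power_bound: "\<exists>K\<ge>0. \<forall>n. harm 1 (Suc n) ^ c \<le> K * sqrt (real (Suc n))"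
proof -
  \<comment> \<open>This exponent satisfies a c \<le> 1/2, also for c = 0, so the c-th power of
    \<open>x powr a\<close> stays below the square root of x.\<close>
  define a :: real where "a = 1 / (2 * (real c + 1))"
  have a: "a > 0" by (simp add: a_def)
  have "harm 1 (Suc n) ^ c \<le> (1 + 1 / a) ^ c * sqrt (real (Suc n))" for n
  proof -
    define x where "x = real (Suc n)"
    have x: "x \<ge> 1" by (simp add: x_def)
    have "harm 1 (Suc n) \<le> 1 + ln x" unfolding x_def by (rule harm_le_ln)
    also have "\<dots> \<le> 1 + x powr a / a" using ln_powr_bound[OF x a] by simp
    also have "\<dots> \<le> x powr a + x powr a / a" using x a by (simp add: ge_one_powr_ge_zero)
    also have "\<dots> = (1 + 1 / a) * x powr a" by (simp add: algebra_simps)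
    finally have "harm 1 (Suc n) ^ c \<le> ((1 + 1 / a) * x powr a) ^ c"
      by (intro power_mono harm_nonneg)
    also have "\<dots> = (1 + 1 / a) ^ c * x powr (a * real c)"
      using x by (simp add: power_mult_distrib powr_powr[symmetric] powr_realpow)
    also have "\<dots> \<le> (1 + 1 / a) ^ c * x powr (1 / 2)"
      using x a by (intro mult_left_mono powr_mono) (auto simp: a_def field_simps)
    finally show ?thesis using x by (simp add: powr_half_sqrt x_def)
  qed
  moreover have "0 \<le> (1 + 1 / a) ^ c" using a by simp
  ultimately show ?thesis by blast
qed

lemma hsym_esym_bound:
  "\<exists>K\<ge>0. \<forall>n. hsym l (Suc n) * esym k (Suc n) \<le> K * sqrt (real (Suc n))"
proof -
  obtain K where K: "K \<ge> 0" "\<And>n. harm 1 (Suc n) ^ (l + k) \<le> K * sqrt (real (Suc n))"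
    using harm_power_bound by blast
  have "hsym l (Suc n) * esym k (Suc n) \<le> K * sqrt (real (Suc n))" for n
  proof -
    have "hsym l (Suc n) * esym k (Suc n) \<le> harm 1 (Suc n) ^ l * harm 1 (Suc n) ^ k"
      by (intro mult_mono hsym_le_power esym_le_power esym_nonneg zero_le_power harm_nonneg)
    with K(2)[of n] show ?thesis by (simp add: power_add)
  qed
  with K(1) show ?thesis by blast
qed

lemma hsym_esym_over_tendsto_0:
  "(\<lambda>n. hsym l (Suc n) * esym k (Suc n) / real (Suc n)) \<longlonglongrightarrow> 0"
proof -
  obtain K where K: "K \<ge> 0" "\<And>n. hsym l (Suc n) * esym k (Suc n) \<le> K * sqrt (real (Suc n))"
    using hsym_esym_bound by blast
  show ?thesis
  proof (rule tendsto_sandwich[OF _ _ tendsto_const])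
    show "\<forall>\<^sub>F n in sequentially. 0 \<le> hsym l (Suc n) * esym k (Suc n) / real (Suc n)"
      by (simp add: hsym_nonneg esym_nonneg)
    have "hsym l (Suc n) * esym k (Suc n) / real (Suc n) \<le> K / sqrt (real (Suc n))" for n
    proof -
      have "hsym l (Suc n) * esym k (Suc n) / real (Suc n) \<le> K * sqrt (real (Suc n)) / real (Suc n)"
        by (intro divide_right_mono K) simp
      also have "\<dots> = K / sqrt (real (Suc n))"
        by (simp add: divide_simps del: of_nat_Suc)
      finally show ?thesis .
    qed
    then show "\<forall>\<^sub>F n in sequentially. hsym l (Suc n) * esym k (Suc n) / real (Suc n) \<le> K / sqrt (real (Suc n))"
      by simp
    have "filterlim (\<lambda>n. sqrt (real (Suc n))) at_top sequentially"
      by (intro filterlim_compose[OF sqrt_at_top] filterlim_compose[OF filterlim_real_sequentially] filterlim_Suc)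
    then show "(\<lambda>n. K / sqrt (real (Suc n))) \<longlonglongrightarrow> 0"
      by (rule tendsto_divide_0[OF tendsto_const filterlim_at_top_imp_at_infinity])
  qed
qed

lemma sqrt_Suc_le: "sqrt (real (Suc (Suc n))) \<le> 2 * sqrt (real (Suc n))"
  by (rule real_le_lsqrt) (simp_all add: power_mult_distrib)

text \<open>With b^2 = a^2 + 1 the difference 1/a - 1/b is 1 / (a b (a + b)), and b \<le> 2 a gives
  a + b \<le> 3 a; hence the constant 3. The telescoping majorant yields summability and explicit
  tail bounds together.\<close>

lemma sqrt_telescope:
  "1 / (real (Suc n) * sqrt (real (Suc (Suc n)))) \<le> 3 * (1 / sqrt (real (Suc n)) - 1 / sqrt (real (Suc (Suc n))))"
proof -
  define a b where "a = sqrt (real (Suc n))" and "b = sqrt (real (Suc (Suc n)))"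
  have a: "a \<ge> 1" and sq: "a\<^sup>2 = real (Suc n)" "b\<^sup>2 = a\<^sup>2 + 1" and b: "b > 0"
    by (simp_all add: a_def b_def)
  have ab: "b \<le> 2 * a" unfolding a_def b_def by (rule sqrt_Suc_le)
  have "1 = (b - a) * (b + a)" using sq by (simp add: power2_eq_square algebra_simps)
  also have "\<dots> \<le> (b - a) * (3 * a)"
  proof (intro mult_left_mono)
    show "0 \<le> b - a" by (simp add: a_def b_def)
  qed (use ab in simp)
  finally have "1 / (a\<^sup>2 * b) \<le> (b - a) * (3 * a) / (a\<^sup>2 * b)"
    using a b by (intro divide_right_mono) auto
  also have "\<dots> = 3 * (1 / a - 1 / b)"
    using a b by (simp add: field_simps power2_eq_square)
  finally show ?thesis unfolding sq(1) by (simp only: a_def b_def)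
qed

lemma inverse_sqrt_sums:
  "(\<lambda>i. 3 * (1 / sqrt (real (Suc (j + i))) - 1 / sqrt (real (Suc (Suc (j + i)))))) sums (3 / sqrt (real (Suc j)))"
proof -
  have "filterlim (\<lambda>i. sqrt (real (Suc (j + i)))) at_top sequentially"
    by (intro filterlim_compose[OF sqrt_at_top] filterlim_compose[OF filterlim_real_sequentially]
        filterlim_compose[OF filterlim_Suc] filterlim_at_top_mono[OF filterlim_ident]) auto
  then have "(\<lambda>i. 1 / sqrt (real (Suc (j + i)))) \<longlonglongrightarrow> 0"
    by (rule tendsto_divide_0[OF tendsto_const filterlim_at_top_imp_at_infinity])
  from sums_mult[OF telescope_sums'[OF this], of 3] show ?thesis by simp
qed

text \<open>The square root bound leaves terms of order n^(-3/2), which the telescoping majorant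
  dominates.\<close>

lemma hsym_esym_summable:
  "summable (\<lambda>n. hsym l (Suc n) * esym k n / real (Suc n) ^ 2)"
proof -
  obtain K where K: "K \<ge> 0" "\<And>n. hsym l (Suc n) * esym k (Suc n) \<le> K * sqrt (real (Suc n))"
    using hsym_esym_bound by blast
  have le: "hsym l (Suc n) * esym k n / real (Suc n) ^ 2
       \<le> 2 * K * (3 * (1 / sqrt (real (Suc (0 + n))) - 1 / sqrt (real (Suc (Suc (0 + n))))))" for n
  proof -
    define a b where "a = sqrt (real (Suc n))" and "b = sqrt (real (Suc (Suc n)))"
    have a: "a \<ge> 1" and sq: "a\<^sup>2 = real (Suc n)" "b\<^sup>2 = a\<^sup>2 + 1" and b: "b > 0"
      by (simp_all add: a_def b_def)
    have ab: "b \<le> 2 * a" unfolding a_def b_def by (rule sqrt_Suc_le)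
    have "hsym l (Suc n) * esym k n \<le> hsym l (Suc n) * esym k (Suc n)"
      by (intro mult_left_mono esym_mono hsym_nonneg)
    also have "\<dots> \<le> K * a" unfolding a_def by (rule K)
    finally have "hsym l (Suc n) * esym k n / real (Suc n) ^ 2 \<le> K * a / (a\<^sup>2)\<^sup>2"
      unfolding sq by (intro divide_right_mono) auto
    also have "\<dots> \<le> 2 * K * (1 / (a\<^sup>2 * b))"
    proof -
      have "K * b \<le> K * (2 * a)" using ab K(1) by (intro mult_left_mono) auto
      then show ?thesis using a b by (simp add: field_simps power2_eq_square)
    qed
    also have "\<dots> \<le> 2 * K * (3 * (1 / sqrt (real (Suc n)) - 1 / sqrt (real (Suc (Suc n)))))"
    proof (rule mult_left_mono)
      show "1 / (a\<^sup>2 * b) \<le> 3 * (1 / sqrt (real (Suc n)) - 1 / sqrt (real (Suc (Suc n))))"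
        unfolding sq(1) b_def by (rule sqrt_telescope)
    qed (use K(1) in simp)
    finally show ?thesis by simp
  qed
  show ?thesis
    by (rule summable_comparison_test'[OF summable_mult[OF sums_summable[OF inverse_sqrt_sums[of 0]], of "2 * K"]])
       (use le in \<open>simp add: hsym_nonneg esym_nonneg\<close>)
qed

section \<open>The connector and the connected sums\<close>

text \<open>The connector of the connected sums of Seki and Yamamoto.\<close>
definition connector :: "nat \<Rightarrow> nat \<Rightarrow> real" where
  "connector n j = fact n * fact j / fact (n + j)"

lemma connector_0 [simp]: "connector 0 j = 1" "connector n 0 = 1"
  by (simp_all add: connector_def)

lemma connector_commute: "connector n j = connector j n"
  by (simp add: connector_def add.commute)

lemma connector_pos: "0 < connector n j"
  by (simp add: connector_def)

lemma connector_Suc: "real (Suc (n + j)) * connector n (Suc j) = real (Suc j) * connector n j"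
  by (simp add: connector_def divide_simps del: of_nat_Suc)

lemma connector_Suc_left: "real (Suc (n + j)) * connector (Suc n) j = real (Suc n) * connector n j"
  using connector_Suc[of j n] by (simp add: connector_commute add.commute)

lemma connector_Suc_le: "connector n (Suc j) \<le> connector n j"
proof -
  have "real (Suc (n + j)) * connector n (Suc j) \<le> real (Suc (n + j)) * connector n j"
    unfolding connector_Suc using connector_pos[of n j] by (intro mult_right_mono) auto
  then show ?thesis by (simp del: of_nat_Suc)
qed

text \<open>Equality holds at j = 0, and the connector decreases in its second argument.\<close>

lemma connector_le: "connector n (Suc j) \<le> 1 / real (Suc n)"
proof (induction j)
  case 0
  show ?case using connector_Suc[of n 0] by (simp add: field_simps)
next
  case (Suc j)
  then show ?case using connector_Suc_le[of n "Suc j"] by linarith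
qed

lemma connector_tendsto_0: "(\<lambda>j. connector (Suc n) j) \<longlonglongrightarrow> 0"
proof (rule tendsto_sandwich[OF _ _ tendsto_const LIMSEQ_inverse_real_of_nat])
  show "\<forall>\<^sub>F j in sequentially. 0 \<le> connector (Suc n) j"
    by (simp add: connector_pos less_imp_le)
  show "\<forall>\<^sub>F j in sequentially. connector (Suc n) j \<le> inverse (real (Suc j))"
    using connector_le[of _ n] by (simp add: connector_commute inverse_eq_divide)
qed

text \<open>With N = n + 1, C(N,j) - C(N,j+1) = N C(N,j+1) / (j+1), so the series telescopes. It
  trades a factor 1/N for a sum over j.\<close>

lemma connector_sums: "(\<lambda>j. connector (Suc n) (Suc j) / real (Suc j)) sums (1 / real (Suc n))"
proof -
  have "connector (Suc n) (Suc j) / real (Suc j) = (connector (Suc n) j - connector (Suc n) (Suc j)) / real (Suc n)" for j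
    using connector_Suc[of "Suc n" j] by (simp add: field_simps)
  then show ?thesis
    using sums_divide[OF telescope_sums'[OF connector_tendsto_0[of n]], of "real (Suc n)"] by simp
qed

definition conn_term :: "nat \<Rightarrow> nat \<Rightarrow> nat \<Rightarrow> nat \<Rightarrow> real" where
  "conn_term l k j n = hsym l (Suc n) * esym k n / real (Suc n) ^ 2 * connector (Suc n) j"

text \<open>The coefficient of \<open>x\<^sup>l y\<^sup>k\<close> in \<open>R\<^sub>j\<close>.\<close>
definition conn_sum :: "nat \<Rightarrow> nat \<Rightarrow> nat \<Rightarrow> real" where
  "conn_sum l k j = (\<Sum>n. conn_term l k j n)"

lemma conn_term_nonneg: "0 \<le> conn_term l k j n"
  by (simp add: conn_term_def hsym_nonneg esym_nonneg connector_pos less_imp_le)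

lemma conn_term_Suc_le:
  "conn_term l k (Suc j) n \<le> hsym l (Suc n) * esym k n / real (Suc n) ^ 2 * (1 / real (Suc (Suc j)))"
  unfolding conn_term_def using connector_le[of "Suc j" n]
  by (intro mult_left_mono) (simp_all add: hsym_nonneg esym_nonneg connector_commute)

lemma conn_sums: "conn_term l k j sums conn_sum l k j"
proof -
  have "summable (conn_term l k j)"
  proof (cases j)
    case 0
    then show ?thesis using hsym_esym_summable[of l k] by (simp add: conn_term_def[abs_def])
  next
    case (Suc i)
    have "norm (conn_term l k (Suc i) n)
        \<le> hsym l (Suc n) * esym k n / real (Suc n) ^ 2 * (1 / real (Suc (Suc i)))" for n
      using conn_term_Suc_le[of l k i n] conn_term_nonneg[of l k "Suc i" n] by (simp only: real_norm_def abs_of_nonneg)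
    then show ?thesis unfolding Suc
      by (intro summable_comparison_test'[OF summable_mult2[OF hsym_esym_summable[of l k]]])
  qed
  then show ?thesis unfolding conn_sum_def by (rule summable_sums)
qed

text \<open>At index j + 1 the connector is at most 1/(j+2) uniformly in n, and a convergent series
  free of j remains.\<close>

lemma conn_sum_tendsto_0: "conn_sum l k \<longlonglongrightarrow> 0"
proof (rule LIMSEQ_imp_Suc, rule tendsto_sandwich[OF _ _ tendsto_const])
  define S where "S = (\<Sum>n. hsym l (Suc n) * esym k n / real (Suc n) ^ 2)"
  show "\<forall>\<^sub>F j in sequentially. 0 \<le> conn_sum l k (Suc j)"
    unfolding conn_sum_def by (intro always_eventually allI suminf_nonneg sums_summable[OF conn_sums] conn_term_nonneg)
  have "conn_sum l k (Suc j) \<le> S * (1 / real (Suc (Suc j)))" for j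
    unfolding S_def
    by (rule sums_le[OF _ conn_sums sums_mult2[OF summable_sums[OF hsym_esym_summable]]])
       (use conn_term_Suc_le in auto)
  then show "\<forall>\<^sub>F j in sequentially. conn_sum l k (Suc j) \<le> S * (1 / real (Suc (Suc j)))"
    by simp
  have "(\<lambda>j. S * inverse (real (Suc (Suc j)))) \<longlonglongrightarrow> S * 0"
    by (intro tendsto_mult tendsto_const LIMSEQ_Suc[OF LIMSEQ_inverse_real_of_nat])
  then show "(\<lambda>j. S * (1 / real (Suc (Suc j)))) \<longlonglongrightarrow> 0"
    by (simp add: inverse_eq_divide)
qed

text \<open>Put N = n + 1, J = j + 1 and c = C(N,J). Then C(n,J) = c (N+J)/N and C(N,j) = c (N+J)/J;
  after the one-step recursions of h and e, the claim is a rational identity in N and J.\<close>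

lemma conn_term_telescope:
  defines "T \<equiv> \<lambda>l k j n. hsym l n * esym k n * connector n (Suc j)"
  shows "T l k j n - T l k j (Suc n) = real (Suc j) *
     (real (Suc j) * (conn_term l k j n - conn_term l k (Suc j) n)
      - lower (\<lambda>l. conn_term l k j n) l
      - lower (\<lambda>k. conn_term l k j n - conn_term l k (Suc j) n) k)"
proof -
  define N J where "N = real (Suc n)" and "J = real (Suc j)"
  define c where "c = connector (Suc n) (Suc j)"
  define h h' e e' where "h = hsym l (Suc n)" and "h' = lower (\<lambda>l. hsym l (Suc n)) l"
    and "e = esym k n" and "e' = lower (\<lambda>k. esym k n) k"
  have N: "N > 0" and J: "J > 0" by (simp_all add: N_def J_def)
  have c0: "connector n (Suc j) = (N + J) / N * c"
    using connector_Suc_left[of n "Suc j"] N by (simp add: N_def J_def c_def field_simps)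
  have cj: "connector (Suc n) j = (N + J) / J * c"
    using connector_Suc[of "Suc n" j] J by (simp add: N_def J_def c_def field_simps)
  have hn: "hsym l n = h - h' / N" using hsym_step[of l n] by (simp add: h_def h'_def N_def)
  have en: "esym k (Suc n) = e + e' / N" using esym_step[of k n] by (simp add: e_def e'_def N_def)
  have l1: "lower (\<lambda>l. conn_term l k j n) l = h' * e / N\<^sup>2 * ((N + J) / J * c)"
    unfolding h'_def by (cases l) (simp_all add: conn_term_def e_def N_def cj)
  have l2: "lower (\<lambda>k. conn_term l k j n - conn_term l k (Suc j) n) k
     = h * e' / N\<^sup>2 * ((N + J) / J * c) - h * e' / N\<^sup>2 * c"
    unfolding e'_def by (cases k) (simp_all add: conn_term_def h_def N_def cj flip: c_def)
  have t: "conn_term l k j n = h * e / N\<^sup>2 * ((N + J) / J * c)"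
    "conn_term l k (Suc j) n = h * e / N\<^sup>2 * c"
    by (simp_all add: conn_term_def h_def N_def cj e_def flip: c_def)
  show ?thesis unfolding T_def l1 l2 t hn en c0 unfolding h_def[symmetric] e_def[symmetric] c_def[symmetric] J_def[symmetric]
    using N J by (simp add: field_simps power2_eq_square)
qed

lemma sums_lower:
  assumes "\<And>l. f l sums F l"
  shows "(\<lambda>n. lower (\<lambda>l. f l n) l) sums lower F l"
  using assms by (cases l) simp_all

text \<open>Coefficient form of (J-x-y) R_j - (J-y) R_(j+1) = 1/J with J = j + 1. Summing the
  telescoping identity over n leaves the boundary value at n = 0, which is 1 if l = k = 0 and
  otherwise 0.\<close>

lemma conn_sum_rec:
  "real (Suc j) * (conn_sum l k j - conn_sum l k (Suc j)) =
     lower (\<lambda>l. conn_sum l k j) l + lower (\<lambda>k. conn_sum l k j - conn_sum l k (Suc j)) k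
     + (if l = 0 \<and> k = 0 then 1 / real (Suc j) else 0)"
proof -
  define T where "T n = hsym l n * esym k n * connector n (Suc j)" for n
  have "T \<longlonglongrightarrow> 0"
  proof (rule LIMSEQ_imp_Suc, rule tendsto_sandwich[OF _ _ tendsto_const hsym_esym_over_tendsto_0])
    show "\<forall>\<^sub>F n in sequentially. 0 \<le> T (Suc n)"
      by (simp add: T_def hsym_nonneg esym_nonneg connector_pos less_imp_le)
    have "T (Suc n) \<le> hsym l (Suc n) * esym k (Suc n) / real (Suc n)" for n
    proof -
      have "connector (Suc n) (Suc j) \<le> 1 / real (Suc (Suc n))" by (rule connector_le)
      also have "\<dots> \<le> 1 / real (Suc n)" by (simp add: field_simps)
      finally have "T (Suc n) \<le> hsym l (Suc n) * esym k (Suc n) * (1 / real (Suc n))"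
        unfolding T_def by (intro mult_left_mono) (simp_all add: hsym_nonneg esym_nonneg)
      then show ?thesis by simp
    qed
    then show "\<forall>\<^sub>F n in sequentially. T (Suc n) \<le> hsym l (Suc n) * esym k (Suc n) / real (Suc n)"
      by simp
  qed
  from telescope_sums'[OF this]
  have 1: "(\<lambda>n. T n - T (Suc n)) sums T 0" by simp
  have 2: "(\<lambda>n. T n - T (Suc n)) sums (real (Suc j) *
     (real (Suc j) * (conn_sum l k j - conn_sum l k (Suc j))
      - lower (\<lambda>l. conn_sum l k j) l
      - lower (\<lambda>k. conn_sum l k j - conn_sum l k (Suc j)) k))"
    unfolding T_def conn_term_telescope
    by (intro sums_mult sums_diff conn_sums sums_lower)
  have T0: "T 0 = real (Suc j) * (if l = 0 \<and> k = 0 then 1 / real (Suc j) else 0)"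
    unfolding T_def by (cases l; cases k) simp_all
  have "(if l = 0 \<and> k = 0 then 1 / real (Suc j) else 0) =
     real (Suc j) * (conn_sum l k j - conn_sum l k (Suc j))
      - lower (\<lambda>l. conn_sum l k j) l - lower (\<lambda>k. conn_sum l k j - conn_sum l k (Suc j)) k"
    using sums_unique2[OF 1 2] unfolding T0 by (simp del: of_nat_Suc)
  then show ?thesis by linarith
qed

text \<open>Tonelli: nonnegativity turns the convergent iterated series into an unordered double
  sum, which may be summed in either order.\<close>

lemma sums_swap_nonneg:
  fixes f :: "nat \<Rightarrow> nat \<Rightarrow> real"
  assumes nonneg: "\<And>n m. 0 \<le> f n m"
    and rows: "\<And>n. (\<lambda>m. f n m) sums a n" and total: "a sums S"
    and cols: "\<And>m. (\<lambda>n. f n m) sums b m"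
  shows "b sums S"
proof -
  have a: "0 \<le> a n" for n by (rule sums_le[OF nonneg sums_zero rows])
  have A: "(a has_sum S) UNIV" using total a by (rule sums_nonneg_imp_has_sum)
  have R: "((\<lambda>m. (\<lambda>(n, m). f n m) (n, m)) has_sum a n) UNIV" for n
    using sums_nonneg_imp_has_sum[OF rows nonneg] by simp
  have "(\<lambda>(n, m). f n m) summable_on UNIV \<times> UNIV"
    by (rule summable_on_SigmaI[OF R]) (use A nonneg in \<open>auto simp: summable_on_def\<close>)
  then have "((\<lambda>(n, m). f n m) has_sum S) (UNIV \<times> UNIV)"
    by (intro has_sum_SigmaI[OF R A])
  then have "((\<lambda>(m, n). f n m) has_sum S) (UNIV \<times> UNIV)"
    by (subst (asm) has_sum_swap) simp
  then have "(b has_sum S) UNIV"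
    by (rule has_sum_SigmaD) (use sums_nonneg_imp_has_sum[OF cols nonneg] in simp)
  then show ?thesis by (rule has_sum_imp_sums)
qed

section \<open>The value at j = 0 by a doubly telescoping series\<close>

text \<open>\<open>rising_inv m n\<close> is the expansion of \<open>1 / ((m - x) (m + 1 - x) \<dots> (m + n - 1 - x))\<close>. The terms
  \<open>fact n * esym k n * rcoeff m (n + 2) l\<close> telescope in \<open>m\<close> as well as in \<open>n\<close>; comparing both orders
  of summation evaluates \<open>R\<^sub>0\<close>.\<close>
definition rising_inv :: "nat \<Rightarrow> nat \<Rightarrow> real fps" where
  "rising_inv m n = (\<Prod>t<n. inverse (fps_const (real (m + t)) - fps_X))"

lemma linear_fps_inverse:
  assumes "c \<noteq> 0"
  shows "(fps_const c - fps_X) * (inverse (fps_const c - fps_X) * G) = (G :: real fps)"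
proof -
  have "inverse (fps_const c - fps_X) * (fps_const c - fps_X) = (1 :: real fps)"
    by (rule inverse_mult_eq_1) (use assms in simp)
  then show ?thesis by (metis mult.assoc mult.commute mult_1)
qed

lemma rising_inv_last:
  assumes "m > 0"
  shows "(fps_const (real (m + n)) - fps_X) * rising_inv m (Suc n) = rising_inv m n"
  unfolding rising_inv_def prod.lessThan_Suc mult.commute[of "prod _ _"]
  by (rule linear_fps_inverse) (use assms in simp)

lemma rising_inv_first:
  assumes "m > 0"
  shows "(fps_const (real m) - fps_X) * rising_inv m (Suc n) = rising_inv (Suc m) n"
  unfolding rising_inv_def prod.lessThan_Suc_shift add_0_right add_Suc_right add_Suc
  by (rule linear_fps_inverse) (use assms in simp)

definition rcoeff :: "nat \<Rightarrow> nat \<Rightarrow> nat \<Rightarrow> real" where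
  "rcoeff m n l = fps_nth (rising_inv m n) l"

lemma fps_nth_linear_mult:
  "fps_nth ((fps_const c - fps_X) * G) l = c * fps_nth G l - lower (fps_nth G) l"
  by (cases l) (simp_all add: left_diff_distrib)

lemma rcoeff_last:
  assumes "m > 0"
  shows "real (m + n) * rcoeff m (Suc n) l = rcoeff m n l + lower (rcoeff m (Suc n)) l"
  using fps_nth_linear_mult[of "real (m + n)" "rising_inv m (Suc n)" l]
  unfolding rising_inv_last[OF assms] rcoeff_def[abs_def] by simp

lemma rcoeff_first:
  assumes "m > 0"
  shows "real m * rcoeff m (Suc n) l = rcoeff (Suc m) n l + lower (rcoeff m (Suc n)) l"
  using fps_nth_linear_mult[of "real m" "rising_inv m (Suc n)" l]
  unfolding rising_inv_first[OF assms] rcoeff_def[abs_def] by simp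

text \<open>Cancelling the last and cancelling the first factor give two relations with the same
  \<open>lower\<close> term; their difference is free of it and telescopes in m.\<close>

lemma rcoeff_diff:
  assumes "m > 0"
  shows "real n * rcoeff m (Suc n) l = rcoeff m n l - rcoeff (Suc m) n l"
  using rcoeff_first[OF assms, of n l] rcoeff_last[OF assms, of n l] by (simp add: algebra_simps)

lemma rcoeff_0: "rcoeff m 0 l = (if l = 0 then 1 else 0)"
  by (simp add: rcoeff_def rising_inv_def)

lemma rcoeff_nonneg:
  assumes "m > 0"
  shows "0 \<le> rcoeff m n l"
proof (induction n arbitrary: l)
  case (Suc n)
  show ?case
  proof (induction l)
    case 0
    have "0 \<le> real (m + n) * rcoeff m (Suc n) 0" unfolding rcoeff_last[OF assms] using Suc by simp
    then show ?case using assms by (simp add: zero_le_mult_iff)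
  next
    case (Suc l)
    have "0 \<le> real (m + n) * rcoeff m (Suc n) (Suc l)"
      unfolding rcoeff_last[OF assms] using Suc \<open>\<And>l. 0 \<le> rcoeff m n l\<close> by simp
    then show ?case using assms by (simp add: zero_le_mult_iff)
  qed
qed (simp add: rcoeff_0)

text \<open>Since 1/(t - x) = (1/t) / (1 - x/t), the product for m = 1 is the generating function of
  h_l(n) divided by n!.\<close>

lemma rcoeff_one: "rcoeff 1 n l = hsym l n / fact n"
proof (induction n arbitrary: l)
  case 0
  then show ?case by (cases l) (simp_all add: rcoeff_0)
next
  case (Suc n)
  note IH = this
  show ?case
  proof (induction l)
    case 0
    have "real (Suc n) * rcoeff 1 (Suc n) 0 = real (Suc n) * (1 / fact (Suc n))"
      using rcoeff_last[of 1 n 0] IH[of 0] by simp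
    then have "rcoeff 1 (Suc n) 0 = 1 / fact (Suc n)" by (simp only: mult_cancel_left) simp
    then show ?case by simp
  next
    case (Suc l)
    have "real (Suc n) * rcoeff 1 (Suc n) (Suc l) = hsym (Suc l) n / fact n + hsym l (Suc n) / fact (Suc n)"
      using rcoeff_last[of 1 n "Suc l"] IH Suc by simp
    also have "\<dots> = real (Suc n) * (hsym (Suc l) (Suc n) / fact (Suc n))"
      unfolding hsym_Suc by (simp add: divide_simps distrib_left distrib_right mult_ac del: of_nat_Suc)
    finally show ?case by (simp only: mult_cancel_left) simp
  qed
qed

lemma rcoeff_le_one:
  assumes "m > 0"
  shows "rcoeff m n l \<le> rcoeff 1 n l"
  using assms
proof (induction m rule: nat_induct_non_zero)
  case (Suc m)
  have "0 \<le> real n * rcoeff m (Suc n) l" using Suc(1) by (simp add: rcoeff_nonneg)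
  then show ?case using Suc rcoeff_diff[of m n l] by simp
qed simp

text \<open>By \<open>rcoeff_first\<close>, m times the coefficient is a sum of terms bounded by
  their values at m = 1, so it decays like 1/m.\<close>

lemma rcoeff_tendsto_0: "(\<lambda>m. rcoeff (Suc m) (Suc n) l) \<longlonglongrightarrow> 0"
proof -
  define K where "K = rcoeff 1 n l + lower (rcoeff 1 (Suc n)) l"
  have "rcoeff (Suc m) (Suc n) l \<le> K * inverse (real (Suc m))" for m
  proof -
    have "real (Suc m) * rcoeff (Suc m) (Suc n) l \<le> K"
      unfolding K_def rcoeff_first[OF zero_less_Suc]
    proof (rule add_mono)
      show "rcoeff (Suc (Suc m)) n l \<le> rcoeff 1 n l" by (rule rcoeff_le_one) simp
      show "lower (rcoeff (Suc m) (Suc n)) l \<le> lower (rcoeff 1 (Suc n)) l"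
        by (cases l) (simp_all only: lower_0 lower_Suc order_refl rcoeff_le_one[OF zero_less_Suc])
    qed
    then show ?thesis by (simp add: field_simps)
  qed
  then have upper: "\<forall>\<^sub>F m in sequentially. rcoeff (Suc m) (Suc n) l \<le> K * inverse (real (Suc m))"
    by simp
  have lim: "(\<lambda>m. K * inverse (real (Suc m))) \<longlonglongrightarrow> 0"
    using tendsto_mult[OF tendsto_const LIMSEQ_inverse_real_of_nat, of K] by simp
  show ?thesis
    by (rule tendsto_sandwich[OF _ upper tendsto_const lim]) (simp add: rcoeff_nonneg)
qed

lemma rcoeff_single:
  assumes "m > 0"
  shows "rcoeff m 1 l = 1 / real m ^ Suc l"
proof (induction l)
  case 0
  show ?case using rcoeff_last[OF assms, of 0 0] assms by (simp add: rcoeff_0 field_simps)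
next
  case (Suc l)
  have "real m * rcoeff m 1 (Suc l) = 1 / real m ^ Suc l"
    using rcoeff_last[OF assms, of 0 "Suc l"] Suc by (simp add: rcoeff_0)
  also have "\<dots> = real m * (1 / real m ^ Suc (Suc l))" using assms by simp
  finally show ?case using assms by (simp only: mult_cancel_left) simp
qed

text \<open>The sum over m telescopes by \<open>rcoeff_diff\<close> to the value at m = 1, known
  from \<open>rcoeff_one\<close>.\<close>

lemma rising_row_sums:
  "(\<lambda>m. fact n * esym k n * rcoeff (Suc m) (Suc (Suc n)) l) sums
     (hsym l (Suc n) * esym k n / real (Suc n) ^ 2)"
proof -
  have "(\<lambda>m. rcoeff (Suc m) (Suc n) l - rcoeff (Suc (Suc m)) (Suc n) l) sums (rcoeff 1 (Suc n) l)"
    using telescope_sums'[OF rcoeff_tendsto_0[of n l]] by simp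
  then have "(\<lambda>m. fact n * esym k n / real (Suc n) * (real (Suc n) * rcoeff (Suc m) (Suc (Suc n)) l)) sums
      (fact n * esym k n / real (Suc n) * (hsym l (Suc n) / fact (Suc n)))"
    unfolding rcoeff_diff[OF zero_less_Suc] rcoeff_one[symmetric] by (rule sums_mult)
  moreover have "fact n * esym k n / real (Suc n) * (hsym l (Suc n) / fact (Suc n))
      = hsym l (Suc n) * esym k n / real (Suc n) ^ 2"
    by (simp add: power2_eq_square divide_simps del: of_nat_Suc)
  moreover have "fact n * esym k n / real (Suc n) * (real (Suc n) * x) = fact n * esym k n * x" for x
    by (simp del: of_nat_Suc)
  ultimately show ?thesis by (simp only:)
qed

text \<open>The sum over n telescopes up to terms with l or k lowered by one, so induction on l + k
  applies.\<close>

lemma rising_column_sums: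
  assumes m: "m > 0"
  shows "(\<lambda>n. fact n * esym k n * rcoeff m (Suc (Suc n)) l) sums
     (real ((l + k + 1) choose (k + 1)) / real m ^ (l + k + 2))"
proof (induction "l + k" arbitrary: l k rule: less_induct)
  case less
  define f where "f l k n = fact n * esym k n * rcoeff m (Suc (Suc n)) l" for l k n
  define S where "S l k = real ((l + k + 1) choose (k + 1)) / real m ^ (l + k + 2)" for l k
  define T where "T n = fact n * esym k n * rcoeff m (Suc n) l" for n
  have step: "T n - T (Suc n) = real m * f l k n - lower (\<lambda>l. f l k n) l - lower (\<lambda>k. f l k n) k" for n
  proof -
    define c c' where "c = rcoeff m (Suc (Suc n)) l" and "c' = lower (rcoeff m (Suc (Suc n))) l"
    have 1: "rcoeff m (Suc n) l = (real m + real (Suc n)) * c - c'"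
      using rcoeff_last[OF m, of "Suc n" l] by (simp add: c_def c'_def add_ac)
    have 2: "lower (\<lambda>l. f l k n) l = fact n * esym k n * c'"
      unfolding c'_def f_def by (cases l) simp_all
    have 3: "lower (\<lambda>k. f l k n) k = fact n * lower (\<lambda>k. esym k n) k * c"
      unfolding c_def f_def by (cases k) simp_all
    have 4: "fact (Suc n) * esym k (Suc n) = fact n * (real (Suc n) * esym k n + lower (\<lambda>k. esym k n) k)"
      unfolding esym_step[of k n] by (simp add: field_simps)
    show ?thesis unfolding T_def 1 2 3 4 unfolding f_def c_def[symmetric] by (simp add: algebra_simps)
  qed
  have "T \<longlonglongrightarrow> 0"
  proof (rule tendsto_sandwich[OF _ _ tendsto_const hsym_esym_over_tendsto_0[of l k]])
    show "\<forall>\<^sub>F n in sequentially. 0 \<le> T n"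
      using m by (simp add: T_def esym_nonneg rcoeff_nonneg)
    have "T n \<le> hsym l (Suc n) * esym k (Suc n) / real (Suc n)" for n
    proof -
      have "T n \<le> fact n * esym k (Suc n) * rcoeff 1 (Suc n) l"
        unfolding T_def using m
        by (intro mult_mono esym_mono rcoeff_le_one) (simp_all add: esym_nonneg rcoeff_nonneg)
      also have "\<dots> = hsym l (Suc n) * esym k (Suc n) / real (Suc n)"
        unfolding rcoeff_one by (simp add: divide_simps del: of_nat_Suc)
      finally show ?thesis .
    qed
    then show "\<forall>\<^sub>F n in sequentially. T n \<le> hsym l (Suc n) * esym k (Suc n) / real (Suc n)" by simp
  qed
  from telescope_sums'[OF this]
  have tel: "(\<lambda>n. real m * f l k n - lower (\<lambda>l. f l k n) l - lower (\<lambda>k. f l k n) k) sums T 0"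
    by (simp add: step)
  have IH: "f l' k' sums S l' k'" if "l' + k' < l + k" for l' k'
    using less[OF that] unfolding f_def[abs_def] S_def .
  have L: "(\<lambda>n. lower (\<lambda>l. f l k n) l) sums lower (\<lambda>l. S l k) l"
    using IH[of "l - 1" k] by (cases l) simp_all
  have K: "(\<lambda>n. lower (\<lambda>k. f l k n) k) sums lower (S l) k"
    using IH[of l "k - 1"] by (cases k) simp_all
  have "(\<lambda>n. (real m * f l k n - lower (\<lambda>l. f l k n) l - lower (\<lambda>k. f l k n) k
        + lower (\<lambda>l. f l k n) l + lower (\<lambda>k. f l k n) k) / real m) sums
      ((T 0 + lower (\<lambda>l. S l k) l + lower (S l) k) / real m)"
    by (intro sums_divide sums_add tel L K)
  then have "f l k sums ((T 0 + lower (\<lambda>l. S l k) l + lower (S l) k) / real m)"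
    using m by simp
  \<comment> \<open>For k > 0 the boundary term vanishes and this is Pascal's rule; for k = 0 it
    supplies the 1 in l + 1.\<close>
  moreover have "T 0 + lower (\<lambda>l. S l k) l + lower (S l) k = real m * S l k"
  proof (cases k)
    case 0
    have "T 0 = 1 / real m ^ Suc l" using rcoeff_single[OF m, of l] by (simp add: T_def 0)
    then show ?thesis using m 0 by (cases l) (simp_all add: S_def field_simps)
  next
    case (Suc k')
    have "T 0 = 0" by (simp add: T_def Suc)
    then show ?thesis using m Suc by (cases l) (simp_all add: S_def field_simps)
  qed
  ultimately have "f l k sums S l k" using m by simp
  then show ?case unfolding f_def S_def .
qed

lemma conn_sum_0_sums:
  "(\<lambda>i. real ((l + k + 1) choose (k + 1)) / real (Suc i) ^ (l + k + 2)) sums conn_sum l k 0"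
proof (rule sums_swap_nonneg[OF _ rising_row_sums])
  show "(\<lambda>n. hsym l (Suc n) * esym k n / real (Suc n) ^ 2) sums conn_sum l k 0"
    using conn_sums[of l k 0] by (simp add: conn_term_def[abs_def])
  show "(\<lambda>n. fact n * esym k n * rcoeff (Suc i) (Suc (Suc n)) l) sums
     (real ((l + k + 1) choose (k + 1)) / real (Suc i) ^ (l + k + 2))" for i
    by (rule rising_column_sums) simp
qed (simp add: esym_nonneg rcoeff_nonneg)

section \<open>Tails of multiple zeta values\<close>

text \<open>The list is read from the last argument to the first, so that the head belongs to the smallest
  summation index; all indices exceed \<open>j\<close>.\<close>
primrec tail_mzv :: "nat list \<Rightarrow> nat \<Rightarrow> real" where
  "tail_mzv [] j = 1"
| "tail_mzv (s # b) j = (\<Sum>i. tail_mzv b (Suc (j + i)) / real (Suc (j + i)) ^ s)"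

text \<open>In the reversed order the first argument, on which convergence depends, is the
  \<open>last\<close> entry.\<close>

definition rev_admissible :: "nat list \<Rightarrow> bool" where
  "rev_admissible b \<longleftrightarrow> b \<noteq> [] \<and> (\<forall>x\<in>set b. 1 \<le> x) \<and> 2 \<le> last b"

text \<open>Decay like n^(-1/2) reproduces itself under a further summation, up to the factor 3 from
  \<open>sqrt_telescope\<close>, so it can be iterated along an argument list.\<close>

lemma decay_tail_sum:
  assumes g: "\<And>n. 0 \<le> g n" "\<And>n. g n \<le> C / sqrt (real (Suc n))" and s: "1 \<le> s"
  shows "summable (\<lambda>i. g (Suc (j + i)) / real (Suc (j + i)) ^ s)"
    and "(\<Sum>i. g (Suc (j + i)) / real (Suc (j + i)) ^ s) \<le> 3 * C / sqrt (real (Suc j))"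
proof -
  have "0 \<le> C" using order_trans[OF g(1)[of 0] g(2)[of 0]] by simp
  let ?b = "\<lambda>i. C * (3 * (1 / sqrt (real (Suc (j + i))) - 1 / sqrt (real (Suc (Suc (j + i))))))"
  have le: "g (Suc (j + i)) / real (Suc (j + i)) ^ s \<le> ?b i" for i
  proof -
    define N where "N = Suc (j + i)"
    have "real N ^ 1 \<le> real N ^ s" using s by (intro power_increasing) (simp_all add: N_def)
    then have "g N / real N ^ s \<le> g N / real N"
      using g(1) by (intro divide_left_mono) (simp_all add: N_def)
    also have "\<dots> \<le> C / sqrt (real (Suc N)) / real N" by (intro divide_right_mono g) simp
    also have "\<dots> = C * (1 / (real N * sqrt (real (Suc N))))" by simp
    also have "\<dots> \<le> C * (3 * (1 / sqrt (real N) - 1 / sqrt (real (Suc N))))"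
      unfolding N_def by (intro mult_left_mono sqrt_telescope \<open>0 \<le> C\<close>)
    finally show ?thesis by (simp add: N_def)
  qed
  have b: "?b sums (C * (3 / sqrt (real (Suc j))))"
    by (intro sums_mult inverse_sqrt_sums)
  show sm: "summable (\<lambda>i. g (Suc (j + i)) / real (Suc (j + i)) ^ s)"
    by (rule summable_comparison_test'[OF sums_summable[OF b]]) (use le g(1) in simp)
  show "(\<Sum>i. g (Suc (j + i)) / real (Suc (j + i)) ^ s) \<le> 3 * C / sqrt (real (Suc j))"
    using sums_le[OF le summable_sums[OF sm] b] by (simp add: mult.commute)
qed


lemma tail_mzv_decay:
  assumes "rev_admissible b"
  shows "\<exists>C. \<forall>j. 0 \<le> tail_mzv b j \<and> tail_mzv b j \<le> C / sqrt (real (Suc j))"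
    and "summable (\<lambda>i. tail_mzv (tl b) (Suc (j + i)) / real (Suc (j + i)) ^ hd b)"
proof -
  have "(\<exists>C. \<forall>j. 0 \<le> tail_mzv b j \<and> tail_mzv b j \<le> C / sqrt (real (Suc j))) \<and>
    (\<forall>j. summable (\<lambda>i. tail_mzv (tl b) (Suc (j + i)) / real (Suc (j + i)) ^ hd b))"
    using assms
  proof (induction b)
    case Nil
    then show ?case by (simp add: rev_admissible_def)
  next
    case (Cons s b)
    \<comment> \<open>The summand is rewritten as g(n) / n^t with g decaying and t \<ge> 1. The
      empty tail is the constant 1, but then s \<ge> 2 and one factor 1/n can serve as g.\<close>
    obtain g C t where g: "\<And>n. 0 \<le> g n" "\<And>n. g n \<le> C / sqrt (real (Suc n))" "1 \<le> t"
      and eq: "\<And>n. n > 0 \<Longrightarrow> tail_mzv b n / real n ^ s = g n / real n ^ t"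
    proof (cases "b = []")
      case True
      have s: "2 \<le> s" using Cons.prems True by (simp add: rev_admissible_def)
      \<comment> \<open>At n = 0 the left side is 1/0 = 0.\<close>
      have bound: "1 / real n \<le> 2 / sqrt (real (Suc n))" for n
      proof (cases "n = 0")
        case False
        have "sqrt (real (Suc n)) \<le> 2 * real n"
        proof (rule real_le_lsqrt)
          have "real (Suc n) \<le> 2 * real n * 1" using False by simp
          also have "\<dots> \<le> 2 * real n * (2 * real n)" using False by (intro mult_left_mono) auto
          finally show "real (Suc n) \<le> (2 * real n)\<^sup>2" by (simp add: power2_eq_square)
        qed simp
        then show ?thesis using False by (simp add: divide_simps mult.commute)
      qed simp
      have "tail_mzv b n / real n ^ s = (1 / real n) / real n ^ (s - 1)" for n
      proof -
        have "s = Suc (s - 1)" using s by simp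
        then have "real n ^ s = real n * real n ^ (s - 1)" by (metis power_Suc)
        then show ?thesis by (simp add: True)
      qed
      then show thesis using that[of "\<lambda>n. 1 / real n" 2 "s - 1"] bound s by simp
    next
      case False
      then have "rev_admissible b" "1 \<le> s" using Cons.prems by (auto simp: rev_admissible_def)
      then show thesis using Cons.IH that[of "tail_mzv b" _ s] by blast
    qed
    have term_eq: "tail_mzv b (Suc (j + i)) / real (Suc (j + i)) ^ s = g (Suc (j + i)) / real (Suc (j + i)) ^ t" for i j
      by (rule eq) simp
    note ds = decay_tail_sum[of g C t, OF g]
    have "0 \<le> (\<Sum>i. g (Suc (j + i)) / real (Suc (j + i)) ^ t)" for j
      by (rule suminf_nonneg[OF ds(1)]) (simp add: g(1))
    then show ?case using ds unfolding tail_mzv.simps list.sel term_eq by blast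
  qed
  then show "\<exists>C. \<forall>j. 0 \<le> tail_mzv b j \<and> tail_mzv b j \<le> C / sqrt (real (Suc j))"
    and "summable (\<lambda>i. tail_mzv (tl b) (Suc (j + i)) / real (Suc (j + i)) ^ hd b)"
    by blast+
qed

lemma tail_mzv_nonneg: "rev_admissible b \<Longrightarrow> 0 \<le> tail_mzv b j"
  using tail_mzv_decay(1) by blast

lemma tail_mzv_tendsto_0:
  assumes "rev_admissible b"
  shows "tail_mzv b \<longlonglongrightarrow> 0"
proof -
  obtain C where C: "\<And>j. 0 \<le> tail_mzv b j" "\<And>j. tail_mzv b j \<le> C / sqrt (real (Suc j))"
    using tail_mzv_decay(1)[OF assms] by blast
  have "filterlim (\<lambda>n. sqrt (real (Suc n))) at_top sequentially"
    by (intro filterlim_compose[OF sqrt_at_top] filterlim_compose[OF filterlim_real_sequentially] filterlim_Suc)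
  then have lim: "(\<lambda>n. C / sqrt (real (Suc n))) \<longlonglongrightarrow> 0"
    by (rule tendsto_divide_0[OF tendsto_const filterlim_at_top_imp_at_infinity])
  show ?thesis
    by (rule tendsto_sandwich[OF _ _ tendsto_const lim]) (simp_all add: C del: of_nat_Suc)
qed

lemma tail_mzv_sums:
  assumes "rev_admissible (s # b)"
  shows "(\<lambda>i. tail_mzv b (Suc (j + i)) / real (Suc (j + i)) ^ s) sums tail_mzv (s # b) j"
  using tail_mzv_decay(2)[OF assms, of j] by (simp add: summable_sums del: of_nat_Suc)

lemma tail_mzv_diff:
  assumes "rev_admissible (s # b)"
  shows "tail_mzv (s # b) j - tail_mzv (s # b) (Suc j) = tail_mzv b (Suc j) / real (Suc j) ^ s"
proof -
  have "(\<lambda>i. tail_mzv b (Suc (j + Suc i)) / real (Suc (j + Suc i)) ^ s) sums tail_mzv (s # b) (Suc j)"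
    using tail_mzv_sums[OF assms, of "Suc j"] by simp
  from sums_Suc[OF this]
  have "(\<lambda>i. tail_mzv b (Suc (j + i)) / real (Suc (j + i)) ^ s) sums
    (tail_mzv (s # b) (Suc j) + tail_mzv b (Suc j) / real (Suc j) ^ s)" by simp
  from sums_unique2[OF this tail_mzv_sums[OF assms]] show ?thesis by simp
qed

text \<open>The last entry of \<open>ns\<close> is the smallest index j + 1 + i. Splitting it off
  identifies the lists with pairs of i and a shorter list above that index; nonnegativity merges the
  iterated sum into one unordered sum.\<close>

lemma tail_mzv_has_sum:
  assumes "a = [] \<or> rev_admissible (rev a)"
  shows "((\<lambda>ns. \<Prod>i<length a. 1 / real (ns ! i) ^ (a ! i)) has_sum tail_mzv (rev a) j)
    {ns. length ns = length a \<and> sorted_wrt (>) ns \<and> (\<forall>x\<in>set ns. x \<ge> Suc j)}"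
  using assms
proof (induction a arbitrary: j rule: rev_induct)
  case Nil
  have "{ns :: nat list. length ns = length ([] :: nat list) \<and> sorted_wrt (>) ns \<and> (\<forall>x\<in>set ns. x \<ge> Suc j)} = {[]}"
    by auto
  then show ?case using has_sum_finite[of "{[] :: nat list}" "\<lambda>_. 1 :: real"] by simp
next
  case (snoc s a)
  define A where "A a j = {ns :: nat list. length ns = length a \<and> sorted_wrt (>) ns \<and> (\<forall>x\<in>set ns. x \<ge> Suc j)}"
    for a :: "nat list" and j
  define f where "f a ns = (\<Prod>i<length a. 1 / real (ns ! i) ^ (a ! i))" for a ns :: "nat list"
  have adm: "rev_admissible (s # rev a)" using snoc.prems by simp
  then have adm': "a = [] \<or> rev_admissible (rev a)"
    by (auto simp: rev_admissible_def)
  define h where "h = (\<lambda>(i, ns). f a ns / real (Suc (j + i)) ^ s)"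
  have inner: "((\<lambda>ns. h (i, ns)) has_sum (tail_mzv (rev a) (Suc (j + i)) / real (Suc (j + i)) ^ s)) (A a (Suc (j + i)))" for i
    using has_sum_divide_const[OF snoc.IH[OF adm', of "Suc (j + i)"], of "real (Suc (j + i)) ^ s"]
    by (simp add: h_def A_def f_def del: of_nat_Suc)
  have nonneg: "0 \<le> tail_mzv (rev a) i" for i
    using adm' tail_mzv_nonneg by auto
  have outer: "((\<lambda>i. tail_mzv (rev a) (Suc (j + i)) / real (Suc (j + i)) ^ s) has_sum tail_mzv (s # rev a) j) UNIV"
    by (rule sums_nonneg_imp_has_sum[OF tail_mzv_sums[OF adm]]) (simp add: nonneg)
  have "(h has_sum tail_mzv (s # rev a) j) (Sigma UNIV (\<lambda>i. A a (Suc (j + i))))"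
  proof (rule has_sum_SigmaI[OF inner outer])
    show "h summable_on (Sigma UNIV (\<lambda>i. A a (Suc (j + i))))"
      by (rule summable_on_SigmaI[OF inner])
         (use outer in \<open>auto simp: summable_on_def h_def f_def intro!: divide_nonneg_nonneg prod_nonneg\<close>)
  qed
  also have "?this \<longleftrightarrow> (f (a @ [s]) has_sum tail_mzv (s # rev a) j) (A (a @ [s]) j)"
  proof (rule has_sum_reindex_bij_witness[of _ "\<lambda>ns. (last ns - Suc j, butlast ns)" "\<lambda>(i, ns). ns @ [Suc (j + i)]"])
    fix x assume x: "x \<in> Sigma UNIV (\<lambda>i. A a (Suc (j + i)))"
    obtain i ns where [simp]: "x = (i, ns)" by (cases x)
    from x have len: "length ns = length a" by (simp add: A_def)
    show "(last (case x of (i, ns) \<Rightarrow> ns @ [Suc (j + i)]) - Suc j, butlast (case x of (i, ns) \<Rightarrow> ns @ [Suc (j + i)])) = x"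
      by simp
    show "(case x of (i, ns) \<Rightarrow> ns @ [Suc (j + i)]) \<in> A (a @ [s]) j"
      using x by (fastforce simp: A_def sorted_wrt_append)
    have "(\<Prod>t<length a. 1 / real ((ns @ [Suc (j + i)]) ! t) ^ ((a @ [s]) ! t)) = f a ns"
      unfolding f_def by (rule prod.cong) (simp_all add: nth_append len)
    then show "f (a @ [s]) (case x of (i, ns) \<Rightarrow> ns @ [Suc (j + i)]) = h x"
      by (simp add: f_def[of "a @ [s]"] h_def nth_append len)
  next
    fix ns assume ns: "ns \<in> A (a @ [s]) j"
    then have "ns \<noteq> []" by (auto simp: A_def)
    then obtain ms n where [simp]: "ns = ms @ [n]" by (metis append_butlast_last_id)
    show "(case (last ns - Suc j, butlast ns) of (i, ns) \<Rightarrow> ns @ [Suc (j + i)]) = ns"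
      using ns by (simp add: A_def)
    show "(last ns - Suc j, butlast ns) \<in> Sigma UNIV (\<lambda>i. A a (Suc (j + i)))"
      using ns by (auto simp: A_def sorted_wrt_append)
  qed simp
  finally show ?case by (simp add: A_def f_def[abs_def])
qed

lemma mzv_eq_tail_mzv:
  assumes "rev_admissible (rev a)"
  shows "mzv a = tail_mzv (rev a) 0"
  using infsumI[OF tail_mzv_has_sum[of a 0]] assms by (simp add: mzv_def)

section \<open>Tails summed over all arguments of given weight and depth\<close>

definition adm_set :: "nat \<Rightarrow> nat \<Rightarrow> nat list set" where
  "adm_set d w = {b. length b = d \<and> rev_admissible b \<and> sum_list b = w}"

text \<open>The parameters are normalised to start at 0: e is the depth minus 1, and p is the weight
  minus the depth minus 1.\<close>

definition tail_sum :: "nat \<Rightarrow> nat \<Rightarrow> nat \<Rightarrow> real" where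
  "tail_sum e p j = (\<Sum>b\<in>adm_set (Suc e) (e + p + 2). tail_mzv b j)"

lemma finite_adm_set: "finite (adm_set d w)"
proof (rule finite_subset)
  show "adm_set d w \<subseteq> {b. set b \<subseteq> {..w} \<and> length b = d}"
    using member_le_sum_list by (fastforce simp: adm_set_def)
qed (simp add: finite_lists_length_eq)

lemma adm_set_1: "adm_set (Suc 0) (p + 2) = {[p + 2]}"
proof -
  have "b = [p + 2]" if "b \<in> adm_set (Suc 0) (p + 2)" for b
    using that by (cases b) (auto simp: adm_set_def)
  then show ?thesis by (auto simp: adm_set_def rev_admissible_def)
qed

lemma rev_admissible_Cons:
  "b \<noteq> [] \<Longrightarrow> rev_admissible (s # b) \<longleftrightarrow> 1 \<le> s \<and> rev_admissible b"
  by (auto simp: rev_admissible_def)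

text \<open>A head equal to 1 is removed, a larger head is lowered by one. In depth at least 2
  neither touches the condition on the last entry.\<close>

lemma adm_set_Suc:
  "adm_set (Suc (Suc e)) (Suc w) =
     (#) 1 ` adm_set (Suc e) w \<union> (\<lambda>b. Suc (hd b) # tl b) ` adm_set (Suc (Suc e)) w"
  (is "?L = ?A \<union> ?B")
proof (intro equalityI subsetI)
  fix b assume b: "b \<in> ?L"
  then obtain s c where [simp]: "b = s # c" by (cases b) (auto simp: adm_set_def)
  have ne: "c \<noteq> []" using b by (auto simp: adm_set_def)
  then have c: "length c = Suc e" "rev_admissible c" "1 \<le> s" "s + sum_list c = Suc w"
    using b rev_admissible_Cons[of c s] by (auto simp: adm_set_def)
  show "b \<in> ?A \<union> ?B"
  proof (cases "s = 1")
    case True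
    then show ?thesis using c by (auto simp: adm_set_def)
  next
    case False
    then have "(s - 1) # c \<in> adm_set (Suc (Suc e)) w" "b = Suc (hd ((s - 1) # c)) # tl ((s - 1) # c)"
      using c rev_admissible_Cons[OF ne, of "s - 1"] by (auto simp: adm_set_def)
    then show ?thesis by blast
  qed
next
  fix b assume "b \<in> ?A \<union> ?B"
  then show "b \<in> ?L"
  proof
    assume "b \<in> ?A"
    then obtain c where c: "c \<in> adm_set (Suc e) w" "b = 1 # c" by blast
    then have "c \<noteq> []" by (auto simp: adm_set_def)
    with c show ?thesis using rev_admissible_Cons[of c 1] by (auto simp: adm_set_def)
  next
    assume "b \<in> ?B"
    then obtain c where c: "c \<in> adm_set (Suc (Suc e)) w" "b = Suc (hd c) # tl c" by blast
    then obtain s d where "c = s # d" by (cases c) (auto simp: adm_set_def)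
    moreover from this c have "d \<noteq> []" by (auto simp: adm_set_def)
    ultimately show ?thesis
      using c rev_admissible_Cons[of d s] rev_admissible_Cons[of d "Suc s"] by (auto simp: adm_set_def)
  qed
qed

lemma adm_set_minimal: "adm_set d d = {}"
proof -
  have "length b < sum_list b" if "rev_admissible b" for b
    using that
  proof (induction b)
    case (Cons s b)
    then show ?case by (cases "b = []") (auto simp: rev_admissible_Cons, auto simp: rev_admissible_def)
  qed (simp add: rev_admissible_def)
  then show ?thesis by (fastforce simp: adm_set_def)
qed

text \<open>The difference keeps exactly the terms with smallest index J = j + 1. If the argument
  there is 1, multiplication by J leaves a tail of smaller depth beyond J; if it is larger, it
  leaves the same difference with the weight lowered by one.\<close>

lemma tail_sum_rec:
  "real (Suc j) * (tail_sum e p j - tail_sum e p (Suc j)) =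
     lower (\<lambda>p. tail_sum e p j - tail_sum e p (Suc j)) p + lower (\<lambda>e. tail_sum e p (Suc j)) e
     + (if e = 0 \<and> p = 0 then 1 / real (Suc j) else 0)"
proof (cases e)
  case 0
  have ts: "tail_sum 0 p i = tail_mzv [p + 2] i" for p i
    unfolding tail_sum_def using adm_set_1[of p] by simp
  have "rev_admissible [p + 2]" for p by (simp add: rev_admissible_def)
  then have d: "tail_sum 0 p j - tail_sum 0 p (Suc j) = 1 / real (Suc j) ^ (p + 2)" for p
    unfolding ts by (subst tail_mzv_diff) (simp_all only: tail_mzv.simps)
  show ?thesis unfolding 0 d
    by (cases p) (simp_all add: d power2_eq_square divide_simps del: of_nat_Suc)
next
  case (Suc e')
  define D where "D b = tail_mzv b j - tail_mzv b (Suc j)" for b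
  define w where "w = e' + p + 2"
  have TD: "tail_sum e p j - tail_sum e p (Suc j) = (\<Sum>b\<in>adm_set (Suc e) (e + p + 2). D b)" for e p
    by (simp add: tail_sum_def D_def sum_subtractf)
  have "adm_set (Suc e) (e + p + 2) = adm_set (Suc (Suc e')) (Suc w)" by (simp add: Suc w_def)
  then have "tail_sum e p j - tail_sum e p (Suc j) =
      (\<Sum>b\<in>(#) 1 ` adm_set (Suc e') w. D b) + (\<Sum>b\<in>(\<lambda>b. Suc (hd b) # tl b) ` adm_set (Suc (Suc e')) w. D b)"
    unfolding TD adm_set_Suc
  proof (simp, subst sum.union_disjoint)
    show "(#) (Suc 0) ` adm_set (Suc e') w \<inter> (\<lambda>b. Suc (hd b) # tl b) ` adm_set (Suc (Suc e')) w = {}"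
    proof -
      have "hd b \<noteq> 0" if "b \<in> adm_set (Suc (Suc e')) w" for b
        using that by (cases b) (auto simp: adm_set_def rev_admissible_def)
      then show ?thesis by fastforce
    qed
  qed (simp_all add: finite_adm_set)
  also have "(\<Sum>b\<in>(#) 1 ` adm_set (Suc e') w. D b) = (\<Sum>b\<in>adm_set (Suc e') w. D (1 # b))"
    by (subst sum.reindex) (simp_all add: o_def)
  also have "\<dots> = (\<Sum>b\<in>adm_set (Suc e') w. tail_mzv b (Suc j) / real (Suc j))"
  proof (rule sum.cong[OF refl])
    fix b assume "b \<in> adm_set (Suc e') w"
    then have "rev_admissible (1 # b)"
      by (subst rev_admissible_Cons) (auto simp: adm_set_def)
    from tail_mzv_diff[OF this] show "D (1 # b) = tail_mzv b (Suc j) / real (Suc j)"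
      by (simp only: D_def power_one_right)
  qed
  also have "(\<Sum>b\<in>(\<lambda>b. Suc (hd b) # tl b) ` adm_set (Suc (Suc e')) w. D b)
      = (\<Sum>b\<in>adm_set (Suc (Suc e')) w. D (Suc (hd b) # tl b))"
  proof (subst sum.reindex)
    show "inj_on (\<lambda>b. Suc (hd b) # tl b) (adm_set (Suc (Suc e')) w)"
    proof (rule inj_onI)
      fix b c assume "b \<in> adm_set (Suc (Suc e')) w" "c \<in> adm_set (Suc (Suc e')) w"
        "Suc (hd b) # tl b = Suc (hd c) # tl c"
      then show "b = c" by (cases b; cases c) (auto simp: adm_set_def)
    qed
  qed (simp add: o_def)
  also have "\<dots> = (\<Sum>b\<in>adm_set (Suc (Suc e')) w. D b / real (Suc j))"
  proof (rule sum.cong[OF refl])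
    fix b assume b: "b \<in> adm_set (Suc (Suc e')) w"
    then obtain s c where [simp]: "b = s # c" by (cases b) (auto simp: adm_set_def)
    from b have adm: "rev_admissible (s # c)" and c: "c \<noteq> []" by (auto simp: adm_set_def)
    then have adm': "rev_admissible (Suc s # c)" by (auto simp: rev_admissible_Cons)
    show "D (Suc (hd b) # tl b) = D b / real (Suc j)"
      using tail_mzv_diff[OF adm, of j] tail_mzv_diff[OF adm', of j]
      by (simp add: D_def mult.commute del: of_nat_Suc tail_mzv.simps)
  qed
  finally have "real (Suc j) * (tail_sum e p j - tail_sum e p (Suc j)) =
      (\<Sum>b\<in>adm_set (Suc e') w. tail_mzv b (Suc j)) + (\<Sum>b\<in>adm_set (Suc (Suc e')) w. D b)"
    by (simp add: sum_divide_distrib[symmetric] distrib_left del: of_nat_Suc)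
  moreover have "(\<Sum>b\<in>adm_set (Suc e') w. tail_mzv b (Suc j)) = lower (\<lambda>e. tail_sum e p (Suc j)) e"
    by (simp add: Suc tail_sum_def w_def)
  moreover have "(\<Sum>b\<in>adm_set (Suc (Suc e')) w. D b) = lower (\<lambda>p. tail_sum e p j - tail_sum e p (Suc j)) p"
  proof (cases p)
    case 0
    then show ?thesis using adm_set_minimal[of "Suc (Suc e')"] by (simp add: w_def)
  next
    case (Suc p')
    then show ?thesis unfolding TD by (simp add: w_def \<open>e = Suc e'\<close> TD)
  qed
  ultimately show ?thesis using Suc by simp
qed

lemma tail_sum_tendsto_0: "tail_sum e p \<longlonglongrightarrow> 0"
proof -
  have "(\<lambda>j. \<Sum>b\<in>adm_set (Suc e) (e + p + 2). tail_mzv b j) \<longlonglongrightarrow> (\<Sum>b\<in>adm_set (Suc e) (e + p + 2). 0)"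
    by (intro tendsto_sum tail_mzv_tendsto_0) (simp add: adm_set_def)
  then show ?thesis by (simp add: tail_sum_def[abs_def])
qed

section \<open>Comparison of the two generating functions\<close>

text \<open>The coefficient of \<open>x\<^sup>l y\<^sup>k\<close> in the sum of \<open>tail_sum e p j * x\<^sup>e * (x + y)\<^sup>p\<close> over \<open>e\<close> and \<open>p\<close>.\<close>
definition mixed_sum :: "nat \<Rightarrow> nat \<Rightarrow> nat \<Rightarrow> real" where
  "mixed_sum l k j = (\<Sum>e\<le>l. real ((l - e + k) choose k) * tail_sum e (l - e + k) j)"

lemma mixed_sum_tendsto_0: "mixed_sum l k \<longlonglongrightarrow> 0"
proof -
  have "(\<lambda>j. \<Sum>e\<le>l. real ((l - e + k) choose k) * tail_sum e (l - e + k) j)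
      \<longlonglongrightarrow> (\<Sum>e\<le>l. real ((l - e + k) choose k) * 0)"
    by (intro tendsto_sum tendsto_mult tendsto_const tail_sum_tendsto_0)
  then show ?thesis by (simp add: mixed_sum_def[abs_def])
qed

text \<open>Multiplication by x + y on coefficients: by Pascal's rule a shift of p becomes a shift
  of l plus a shift of k.\<close>

lemma binomial_shift_sum:
  fixes D :: "nat \<Rightarrow> nat \<Rightarrow> real"
  defines "M \<equiv> \<lambda>l k. \<Sum>e\<le>l. real ((l - e + k) choose k) * D e (l - e + k)"
  shows "(\<Sum>e\<le>l. real ((l - e + k) choose k) * lower (D e) (l - e + k))
    = lower (\<lambda>l. M l k) l + lower (M l) k"
proof (cases k)
  case 0
  show ?thesis
  proof (cases l)
    case (Suc l')
    have "(\<Sum>e\<le>l'. lower (D e) (Suc l' - e)) = (\<Sum>e\<le>l'. D e (l' - e))"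
      by (rule sum.cong) (simp_all add: Suc_diff_le)
    then show ?thesis by (simp add: Suc 0 M_def)
  qed (simp add: 0)
next
  case (Suc k')
  have "(\<Sum>e\<le>l. real ((l - e + k) choose k) * lower (D e) (l - e + k))
      = (\<Sum>e\<le>l. real ((l - e + k') choose k) * D e (l - e + k')) + M l k'"
    by (simp add: Suc M_def sum.distrib distrib_right)
  also have "(\<Sum>e\<le>l. real ((l - e + k') choose k) * D e (l - e + k')) = lower (\<lambda>l. M l k) l"
  proof (cases l)
    case (Suc l')
    have "(\<Sum>e\<le>l'. real ((Suc l' - e + k') choose k) * D e (Suc l' - e + k')) = M l' k"
      unfolding M_def by (rule sum.cong) (simp_all add: Suc_diff_le \<open>k = Suc k'\<close>)
    then show ?thesis by (simp add: Suc \<open>k = Suc k'\<close>)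
  qed (simp add: Suc)
  finally show ?thesis by (simp add: Suc)
qed

text \<open>For the generating function F_j, \<open>tail_sum_rec\<close> reads J (F_j - F_(j+1)) =
  (x+y) (F_j - F_(j+1)) + x F_(j+1) + 1/J with J = j + 1. The two terms with x combine to x F_j,
  which is the recursion of \<open>conn_sum_rec\<close>.\<close>

lemma mixed_sum_rec:
  "real (Suc j) * (mixed_sum l k j - mixed_sum l k (Suc j)) =
     lower (\<lambda>l. mixed_sum l k j) l + lower (\<lambda>k. mixed_sum l k j - mixed_sum l k (Suc j)) k
     + (if l = 0 \<and> k = 0 then 1 / real (Suc j) else 0)"
proof -
  define D where "D e p = tail_sum e p j - tail_sum e p (Suc j)" for e p
  define M where "M l k = mixed_sum l k j - mixed_sum l k (Suc j)" for l k
  have M: "M l k = (\<Sum>e\<le>l. real ((l - e + k) choose k) * D e (l - e + k))" for l k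
    by (simp add: M_def D_def mixed_sum_def right_diff_distrib sum_subtractf)
  have "real (Suc j) * M l k = (\<Sum>e\<le>l. real ((l - e + k) choose k) * (real (Suc j) * D e (l - e + k)))"
    unfolding M sum_distrib_left by (rule sum.cong) (simp_all only: mult_ac)
  also have "\<dots> = (\<Sum>e\<le>l. real ((l - e + k) choose k) * lower (D e) (l - e + k))
      + (\<Sum>e\<le>l. real ((l - e + k) choose k) * lower (\<lambda>e. tail_sum e (l - (Suc e) + k) (Suc j)) e)
      + (\<Sum>e\<le>l. if e = 0 then if l = 0 \<and> k = 0 then 1 / real (Suc j) else 0 else 0)"
    unfolding sum.distrib[symmetric]
  proof (rule sum.cong[OF refl])
    fix e assume "e \<in> {..l}"
    \<comment> \<open>For e > 0, \<open>lower\<close> evaluates its function at e - 1, where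
      \<open>l - Suc\<close> of the argument is l - e.\<close>
    have "lower (\<lambda>e. tail_sum e (l - Suc e + k) (Suc j)) e = lower (\<lambda>e'. tail_sum e' (l - e + k) (Suc j)) e"
      by (cases e) simp_all
    then show "real ((l - e + k) choose k) * (real (Suc j) * D e (l - e + k)) =
      real ((l - e + k) choose k) * lower (D e) (l - e + k)
      + real ((l - e + k) choose k) * lower (\<lambda>e. tail_sum e (l - Suc e + k) (Suc j)) e
      + (if e = 0 then if l = 0 \<and> k = 0 then 1 / real (Suc j) else 0 else 0)"
      using \<open>e \<in> {..l}\<close> unfolding D_def tail_sum_rec by (auto simp: distrib_left)
  qed
  also have "(\<Sum>e\<le>l. real ((l - e + k) choose k) * lower (D e) (l - e + k)) = lower (\<lambda>l. M l k) l + lower (M l) k"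
    unfolding binomial_shift_sum M ..
  also have "(\<Sum>e\<le>l. real ((l - e + k) choose k) * lower (\<lambda>e. tail_sum e (l - Suc e + k) (Suc j)) e)
      = lower (\<lambda>l. mixed_sum l k (Suc j)) l"
    by (cases l) (simp_all add: sum.atMost_Suc_shift mixed_sum_def del: sum.atMost_Suc)
  also have "(\<Sum>e\<le>l. if e = 0 then if l = 0 \<and> k = 0 then 1 / real (Suc j) else 0 else 0)
      = (if l = 0 \<and> k = 0 then 1 / real (Suc j) else 0)"
    by (simp add: sum.delta)
  finally show ?thesis unfolding M_def[abs_def] by (cases l) simp_all
qed

text \<open>By induction on l + k the lowered terms agree, so both sides have the same increments in
  j. Their difference is constant in j and tends to 0.\<close>

lemma conn_sum_eq_mixed_sum: "conn_sum l k j = mixed_sum l k j"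
proof (induction "l + k" arbitrary: l k j rule: less_induct)
  case less
  define d where "d i = conn_sum l k i - mixed_sum l k i" for i
  have L: "lower (\<lambda>l. conn_sum l k i) l = lower (\<lambda>l. mixed_sum l k i) l" for i
    using less[of "l - 1" k i] by (cases l) simp_all
  have K: "lower (\<lambda>k. conn_sum l k i - conn_sum l k (Suc i)) k = lower (\<lambda>k. mixed_sum l k i - mixed_sum l k (Suc i)) k" for i
    using less[of l "k - 1"] by (cases k) simp_all
  have "real (Suc i) * (conn_sum l k i - conn_sum l k (Suc i)) = real (Suc i) * (mixed_sum l k i - mixed_sum l k (Suc i))" for i
    unfolding conn_sum_rec mixed_sum_rec L K ..
  then have "conn_sum l k i - conn_sum l k (Suc i) = mixed_sum l k i - mixed_sum l k (Suc i)" for i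
    by (simp del: of_nat_Suc)
  then have "d (Suc i) = d i" for i unfolding d_def by (simp add: algebra_simps)
  then have "d i = d 0" for i by (induction i) simp_all
  then have "d = (\<lambda>_. d 0)" by blast
  moreover have "d \<longlonglongrightarrow> 0 - 0"
    unfolding d_def[abs_def] by (intro tendsto_diff conn_sum_tendsto_0 mixed_sum_tendsto_0)
  ultimately have "d 0 = 0" by (metis LIMSEQ_const_iff diff_zero)
  with \<open>d = (\<lambda>_. d 0)\<close> have "d j = 0" by metis
  then show ?case by (simp add: d_def)
qed

section \<open>Appending the argument 1 and conclusion\<close>

text \<open>A final argument 1 is a head 1 of the reversed list: it adds a new smallest index i + 1
  with weight 1/(i+1), below which no old index may fall.\<close>

lemma SR_sums:
  "(\<lambda>i. tail_sum e p (Suc i) / real (Suc i)) sums SR (e + p + 3) (e + 2)"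
proof -
  let ?A = "{a. length a = e + 2 \<and> (\<forall>x\<in>set a. x \<ge> 1) \<and> sum_list a = e + p + 3
                   \<and> a \<noteq> [] \<and> hd a \<ge> 2 \<and> last a = 1}"
  have adm: "rev_admissible (1 # b)" if "b \<in> adm_set (Suc e) (e + p + 2)" for b
    using that by (subst rev_admissible_Cons) (auto simp: adm_set_def)
  have "SR (e + p + 3) (e + 2) = (\<Sum>b\<in>adm_set (Suc e) (e + p + 2). tail_mzv (1 # b) 0)"
    unfolding SR_def
  proof (rule sum.reindex_bij_witness[of _ "\<lambda>b. rev (1 # b)" "\<lambda>a. rev (butlast a)"])
    fix a assume a: "a \<in> ?A"
    define c where "c = butlast a"
    have ac: "a = c @ [1]" using a append_butlast_last_id[of a] by (simp add: c_def)
    have c: "c \<noteq> []" using a ac by auto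
    have mem: "rev c \<in> adm_set (Suc e) (e + p + 2)"
      using a c by (simp add: ac adm_set_def rev_admissible_def last_rev)
    then show "rev (butlast a) \<in> adm_set (Suc e) (e + p + 2)" by (simp only: c_def)
    show "rev (1 # rev (butlast a)) = a" by (simp add: ac)
    have "mzv a = tail_mzv (rev a) 0" by (rule mzv_eq_tail_mzv) (use adm[OF mem] in \<open>simp add: ac\<close>)
    then show "tail_mzv (1 # rev (butlast a)) 0 = mzv a" by (simp only: ac butlast_snoc rev_append rev.simps append.simps)
  next
    fix b assume b: "b \<in> adm_set (Suc e) (e + p + 2)"
    then have "b \<noteq> []" by (auto simp: adm_set_def)
    then show "rev (1 # b) \<in> ?A"
      using b by (simp add: adm_set_def rev_admissible_def hd_rev hd_append)
    show "rev (butlast (rev (1 # b))) = b" by simp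
  qed
  moreover have "(\<lambda>i. \<Sum>b\<in>adm_set (Suc e) (e + p + 2). tail_mzv b (Suc i) / real (Suc i)) sums
      (\<Sum>b\<in>adm_set (Suc e) (e + p + 2). tail_mzv (1 # b) 0)"
  proof (rule sums_sum)
    fix b assume "b \<in> adm_set (Suc e) (e + p + 2)"
    from tail_mzv_sums[OF adm[OF this], of 0]
    show "(\<lambda>i. tail_mzv b (Suc i) / real (Suc i)) sums tail_mzv (1 # b) 0"
      by (simp only: add_0 power_one_right)
  qed
  ultimately show ?thesis by (simp only: tail_sum_def sum_divide_distrib)
qed

lemma conn_sum_0: "conn_sum l k 0 = real ((l + k + 1) choose (k + 1)) * mzv [l + k + 2]"
proof -
  have adm: "rev_admissible [l + k + 2]" by (simp add: rev_admissible_def)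
  have "(\<lambda>i. 1 / real (Suc i) ^ (l + k + 2)) sums mzv [l + k + 2]"
    using tail_mzv_sums[OF adm, of 0] mzv_eq_tail_mzv[of "[l + k + 2]"] adm
    by (simp only: tail_mzv.simps(1) add_0 rev_singleton_conv rev.simps append.simps)
  from sums_mult[OF this, of "real ((l + k + 1) choose (k + 1))"] conn_sum_0_sums[of l k]
  show ?thesis unfolding times_divide_eq_right mult_1_right by (rule sums_unique2[symmetric])
qed

text \<open>One factor 1/(n+1) is expanded by \<open>connector_sums\<close>. Summing over n first
  gives connected sums divided by j + 1, which are sums of tails to which \<open>SR_sums\<close>
  applies.\<close>

lemma cubic_sums:
  "(\<lambda>n. hsym l (Suc n) * esym k n / real (Suc n) ^ 2 * (1 / real (Suc n))) sums
     (\<Sum>e\<le>l. real ((l - e + k) choose k) * SR (l + k + 3) (e + 2))"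
proof (rule sums_swap_nonneg[where f = "\<lambda>j n. conn_term l k (Suc j) n / real (Suc j)"])
  show "0 \<le> conn_term l k (Suc j) n / real (Suc j)" for j n
    by (simp add: conn_term_nonneg)
  show "(\<lambda>n. conn_term l k (Suc j) n / real (Suc j)) sums (mixed_sum l k (Suc j) / real (Suc j))" for j
    unfolding conn_sum_eq_mixed_sum[symmetric] by (intro sums_divide conn_sums)
  have "(\<lambda>j. \<Sum>e\<le>l. real ((l - e + k) choose k) * (tail_sum e (l - e + k) (Suc j) / real (Suc j))) sums
     (\<Sum>e\<le>l. real ((l - e + k) choose k) * SR (e + (l - e + k) + 3) (e + 2))"
    by (intro sums_sum sums_mult SR_sums)
  moreover have "(\<Sum>e\<le>l. real ((l - e + k) choose k) * SR (e + (l - e + k) + 3) (e + 2))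
      = (\<Sum>e\<le>l. real ((l - e + k) choose k) * SR (l + k + 3) (e + 2))"
    by (rule sum.cong) simp_all
  ultimately show "(\<lambda>j. mixed_sum l k (Suc j) / real (Suc j)) sums
     (\<Sum>e\<le>l. real ((l - e + k) choose k) * SR (l + k + 3) (e + 2))"
    by (simp only: mixed_sum_def sum_divide_distrib times_divide_eq_right)
  show "(\<lambda>j. conn_term l k (Suc j) n / real (Suc j)) sums
      (hsym l (Suc n) * esym k n / real (Suc n) ^ 2 * (1 / real (Suc n)))" for n
    using sums_mult[OF connector_sums[of n], of "hsym l (Suc n) * esym k n / real (Suc n) ^ 2"]
    by (simp only: conn_term_def times_divide_eq_right)
qed

theorem mainTheorem18:
  fixes l k :: nat
  shows "(\<lambda>n. Qpoly l (\<lambda>i. harm i n) * Ppoly k (\<lambda>i. harm i n) / (real n + 1) ^ 2)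
           sums (real ((l + k + 1) choose (k + 1)) * mzv [l + k + 2]
                 - (\<Sum>p\<in>{k..<l + k}. real (p choose k) * SR (l + k + 2) (l + k + 1 - p)))"
proof (cases l)
  \<comment> \<open>For l = 0 the sum over p is empty, and the series is the connected sum at j =
    0.\<close>
  case 0
  have "(\<lambda>n. esym k n / (real n + 1) ^ 2) sums conn_sum 0 k 0"
    using conn_sums[of 0 k 0] by (simp add: conn_term_def[abs_def] add.commute)
  then show ?thesis unfolding conn_sum_0 by (simp add: 0 Qpoly_harm Ppoly_harm)
next
  case (Suc l')
  \<comment> \<open>The recursion h_l(n) = h_l(n+1) - h_(l-1)(n+1)/(n+1) splits the series into two
    known ones.\<close>
  have "(\<lambda>n. conn_term l k 0 n - hsym l' (Suc n) * esym k n / real (Suc n) ^ 2 * (1 / real (Suc n))) sums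
      (conn_sum l k 0 - (\<Sum>e\<le>l'. real ((l' - e + k) choose k) * SR (l' + k + 3) (e + 2)))"
    by (intro sums_diff conn_sums cubic_sums)
  moreover have "conn_term l k 0 n - hsym l' (Suc n) * esym k n / real (Suc n) ^ 2 * (1 / real (Suc n))
      = Qpoly l (\<lambda>i. harm i n) * Ppoly k (\<lambda>i. harm i n) / (real n + 1) ^ 2" for n
    unfolding Qpoly_harm Ppoly_harm conn_term_def Suc hsym_Suc
    by (simp add: diff_divide_distrib[symmetric] add_divide_distrib algebra_simps)
  \<comment> \<open>Substitute p = l' - e + k; with l = l' + 1 the depth e + 2 is l + k + 1 -
    p.\<close>
  moreover have "(\<Sum>e\<le>l'. real ((l' - e + k) choose k) * SR (l' + k + 3) (e + 2))
      = (\<Sum>p\<in>{k..<l + k}. real (p choose k) * SR (l + k + 2) (l + k + 1 - p))"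
    by (rule sum.reindex_bij_witness[of _ "\<lambda>p. l' + k - p" "\<lambda>e. l' - e + k"])
       (auto simp: Suc eval_nat_numeral)
  ultimately show ?thesis unfolding conn_sum_0 by (simp only:)
qed

end
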